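(* Let $F(t,x,u,v)$ be a function on a neighborhood $\Delta$ of the origin of $\mathbb{C}_t\times\mathbb{C}_x\times\mathbb{C}_u\times\mathbb{C}_v$, and set $\Delta_0=\Delta\cap\{t=0,u=0,v=0\}$. Suppose that $F$ is holomorphic in $\Delta$, that $F(0,x,0,0)\equiv0$ in $\Delta_0$, and that $\frac{\partial F}{\partial v}(0,x,0,0)=x\,c(x)$ with $c(0)\ne0$. Suppose moreover that $\mathrm{Re}\,c(0)<0$ and $\mathrm{Re}\,\lambda(0)<0$, where $\lambda(x)=\frac{\partial F}{\partial u}(0,x,0,0)$. Let $u(t,x)$ be a holomorphic solution of $$t\frac{\partial u}{\partial t}=F\Bigl(t,x,u,\frac{\partial u}{\partial x}\Bigr)$$ in a neighborhood of $(0,\sigma_0)\times D_{R_0}$ for some $\sigma_0>0$ and $R_0>0$. If $$\varlimsup_{R\to+0}\Bigl[\lim_{\sigma\to+0}\Bigl(\frac{1}{R^2}\sup_{(0,\sigma)\times D_R}|u(t,x)|\Bigr)\Bigr]=0,$$ then $u(t,x)$ can be continued holomorphically up to a neighborhood of $(0,0)\in\mathbb{C}_t\times\mathbb{C}_x$.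
   Context: $D_r=\{z\in\mathbb{C}: |z|<r\}$. The function $c(x)$ is holomorphic near $x=0$. The interval $(0,\sigma_0)$ is a real interval, regarded as a subset of $\mathbb{C}_t$; the suprema are over real $t\in(0,\sigma)$ and complex $x\in D_R$. A solution is understood to satisfy $(t,x,u(t,x),\partial u/\partial x(t,x))\in\Delta$. "$u$ can be continued holomorphically up to a neighborhood of $(0,0)$" means: there are an open neighborhood $V$ of $(0,0)$ in $\mathbb{C}_t\times\mathbb{C}_x$ and a holomorphic function on $V$ that coincides with $u$ on $(0,T_1)\times D_{R_1}$ for some $T_1>0$, $R_1>0$. *)

theory Defs
  imports "HOL-Complex_Analysis.Complex_Analysis"
begin

text \<open>
  Holomorphy in several variables is complex Frechet differentiability at every point: the real
  derivative provided by the library must be complex linear, i.e. of the form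
  \<open>(h, k) \<mapsto> a * h + b * k\<close> with complex coefficients (and similarly for four variables).
  Both definitions are meant for open sets.
\<close>

definition holomorphic2_on :: "(complex \<times> complex \<Rightarrow> complex) \<Rightarrow> (complex \<times> complex) set \<Rightarrow> bool"
  where "holomorphic2_on f S \<longleftrightarrow>
    (\<forall>z\<in>S. \<exists>a b. (f has_derivative (\<lambda>(h, k). a * h + b * k)) (at z))"

definition holomorphic4_on ::
  "(complex \<times> complex \<times> complex \<times> complex \<Rightarrow> complex)
    \<Rightarrow> (complex \<times> complex \<times> complex \<times> complex) set \<Rightarrow> bool"
  where "holomorphic4_on f S \<longleftrightarrow>
    (\<forall>z\<in>S. \<exists>a b c d.
      (f has_derivative (\<lambda>(h, k, l, m). a * h + b * k + c * l + d * m)) (at z))"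

end

(* The hypothesis on u says that u is o(R^2) on discs of radius R, so u_x = o(R) there. Under the
   rescaling u = eta R^2 y(t / T, x / R) the equation becomes
     t y_t = lam(0) y + c(0) x y_x + K(t, x, y, y_x)
   on the unit bidisc, where |y|, |y_x| <= 1 and K is as small as desired (choose eta, then R, then T).

   Existence: the operator t d/dt - lam(0) - c(0) x d/dx multiplies the coefficient of t^n x^l by
   n - lam(0) - c(0) l, whose modulus is at least a multiple of 1 + l. In the algebra of absolutely
   convergent power series its inverse therefore gains an x-derivative, so the rescaled equation has a
   holomorphic solution on the unit bidisc by iteration.

   Uniqueness: the difference w of two solutions satisfies t w_t = A w + B w_x with A, B close to lam(0),
   c(0) x. Running t down to 0 along the characteristics, x moves inwards and t^delta |w|^2 increases,
   while for bounded w it tends to 0. Hence w = 0. *)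

theory Submission
  imports Defs
begin

text \<open>The weight R^2 is critical. If u has size \<eta> R^2 and u_x size \<eta> R, then lam u
  and c x u_x both have size \<eta> R^2, while a term quadratic in u_x has size \<eta> times \<eta>
  R^2. Shrinking R cannot make the latter relatively small; only \<eta> can, and the vanishing limit
  allows any \<eta>. The variation of lam and c is then controlled by R, and the dependence on t, of
  relative size T / (\<eta> R^2), by T.

  The l1 norm of the coefficients is used instead of the sup norm because dividing by numbers of
  modulus at least \<delta> (1 + l) bounds the x-derivative on the same bidisc. With sup norms each
  step of the iteration would bound that derivative by Cauchy's estimate, at the cost of some
  radius.

  One margin \<delta>, with both real parts at most -\<delta>, and one smallness \<delta>/4 serve
  existence and uniqueness. The given u is controlled only for real t, so uniqueness compares the
  two solutions there; the constructed one lives on a complex bidisc around the origin and thereby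
  provides the continuation.\<close>

section \<open>Absolutely convergent power series on the bidisc\<close>

text \<open>\<open>B\<close> bounds the l1 norm of the coefficients, so this is a ball in a Wiener
  algebra. It is a predicate on plain functions because nothing is asked of \<open>f\<close> outside
  the closed bidisc, and because a bound is all that the iteration tracks.\<close>

definition wiener :: "(complex \<Rightarrow> complex \<Rightarrow> complex) \<Rightarrow> real \<Rightarrow> bool"
  where "wiener f B \<longleftrightarrow>
    (\<exists>a S. ((\<lambda>i. norm (a i)) has_sum S) UNIV \<and> S \<le> B \<and>
      (\<forall>t x. norm t \<le> 1 \<longrightarrow> norm x \<le> 1 \<longrightarrow>
        ((\<lambda>(n, l). a (n, l) * t ^ n * x ^ l) has_sum f t x) UNIV))"

lemma norm_monom_le:
  fixes t x :: complex
  assumes "norm t \<le> 1" "norm x \<le> 1"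
  shows "norm (a * t ^ n * x ^ l) \<le> norm a"
proof -
  have "norm t ^ n \<le> 1" "norm x ^ l \<le> 1"
    using assms by (simp_all add: power_le_one)
  then have "norm t ^ n * norm x ^ l \<le> 1"
    by (simp add: mult_le_one)
  from mult_left_mono[OF this, of "norm a"] show ?thesis
    by (simp add: norm_mult norm_power mult.assoc)
qed

lemma wienerI:
  fixes a :: "'i \<Rightarrow> complex"
  assumes a: "((\<lambda>i. norm (a i)) has_sum S) I" and SB: "S \<le> B"
    and f: "\<And>t x. norm t \<le> 1 \<Longrightarrow> norm x \<le> 1 \<Longrightarrow>
      ((\<lambda>i. a i * t ^ p i * x ^ q i) has_sum f t x) I"
  shows "wiener f B"
proof -
  define fib where "fib m = {i \<in> I. (p i, q i) = m}" for m
  have bij: "bij_betw snd (Sigma UNIV fib) I"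
    by (rule bij_betwI[where g = "\<lambda>i. ((p i, q i), i)"]) (auto simp: fib_def)
  have fibI: "fib m \<subseteq> I" for m
    by (auto simp: fib_def)
  define b where "b m = infsum a (fib m)" for m
  define N where "N m = infsum (\<lambda>i. norm (a i)) (fib m)" for m
  have Na: "((\<lambda>i. norm (a i)) has_sum N m) (fib m)" for m
    unfolding N_def using a fibI by (meson has_sum_imp_summable has_sum_infsum summable_on_subset)
  have ba: "(a has_sum b m) (fib m)" for m
    unfolding b_def by (rule has_sum_infsum[OF abs_summable_summable[OF has_sum_imp_summable[OF Na]]])
  have "((\<lambda>z. norm (a (snd z))) has_sum S) (Sigma UNIV fib)"
    using has_sum_reindex_bij_betw[OF bij, of "\<lambda>i. norm (a i)" S] a by simp
  then have NS: "(N has_sum S) UNIV"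
    by (rule has_sum_SigmaD) (simp add: Na)
  have bN: "norm (b m) \<le> N m" for m
    by (rule norm_has_sum_bound[OF Na ba])
  have bs: "(\<lambda>m. norm (b m)) summable_on UNIV"
    by (rule Infinite_Sum.abs_summable_on_comparison_test'[OF has_sum_imp_summable[OF NS]]) (rule bN)
  then obtain S' where S': "((\<lambda>m. norm (b m)) has_sum S') UNIV"
    by (auto simp: summable_on_def)
  have "S' \<le> S"
    by (rule has_sum_mono[OF S' NS bN])
  moreover have "((\<lambda>(n, l). b (n, l) * t ^ n * x ^ l) has_sum f t x) UNIV"
    if "norm t \<le> 1" "norm x \<le> 1" for t x
  proof (rule has_sum_SigmaD)
    show "((\<lambda>z. a (snd z) * t ^ p (snd z) * x ^ q (snd z)) has_sum f t x) (Sigma UNIV fib)"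
      using has_sum_reindex_bij_betw[OF bij, of "\<lambda>i. a i * t ^ p i * x ^ q i" "f t x"] f that by simp
    fix m :: "nat \<times> nat"
    obtain n l where m: "m = (n, l)" by fastforce
    have "((\<lambda>i. a i * (t ^ n * x ^ l)) has_sum b (n, l) * t ^ n * x ^ l) (fib (n, l))"
      unfolding mult.assoc by (rule has_sum_cmult_left[OF ba])
    then show "((\<lambda>i. a (snd (m, i)) * t ^ p (snd (m, i)) * x ^ q (snd (m, i))) has_sum
        (case m of (n, l) \<Rightarrow> b (n, l) * t ^ n * x ^ l)) (fib m)"
      unfolding m prod.case
      by (rule has_sum_cong[THEN iffD1, rotated]) (auto simp: fib_def mult.assoc)
  qed
  ultimately show ?thesis
    unfolding wiener_def using S' SB by (intro exI[of _ b] exI[of _ S']) auto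
qed

lemma wiener_mono: "wiener f B \<Longrightarrow> B \<le> C \<Longrightarrow> wiener f C"
  unfolding wiener_def by force

lemma wiener_norm_le:
  assumes "wiener f B" "norm t \<le> 1" "norm x \<le> 1"
  shows "norm (f t x) \<le> B"
proof -
  obtain a S where a: "((\<lambda>i. norm (a i)) has_sum S) UNIV" "S \<le> B"
      "((\<lambda>(n, l). a (n, l) * t ^ n * x ^ l) has_sum f t x) UNIV"
    using assms unfolding wiener_def by blast
  have "norm (f t x) \<le> S"
    by (rule norm_infsum_le[OF a(3,1)]) (auto intro: norm_monom_le assms)
  with a show ?thesis by simp
qed

lemma wiener_nonneg: "wiener f B \<Longrightarrow> 0 \<le> B"
  by (rule order_trans[OF norm_ge_zero wiener_norm_le[of f B 0 0]]) auto

text \<open>Completeness of the algebra, in the form used for sums, products and substitution: the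
  bounds \<open>B\<close> make the double series over \<open>I \<times> UNIV\<close> absolutely
  convergent, and \<open>wienerI\<close> merges its repeated exponents.\<close>

lemma wiener_has_sum:
  fixes f :: "'i \<Rightarrow> complex \<Rightarrow> complex \<Rightarrow> complex"
  assumes f: "\<And>i. i \<in> I \<Longrightarrow> wiener (f i) (B i)" and B: "(B has_sum C) I"
    and g: "\<And>t x. norm t \<le> 1 \<Longrightarrow> norm x \<le> 1 \<Longrightarrow> ((\<lambda>i. f i t x) has_sum g t x) I"
  shows "wiener g C"
proof -
  define P where "P i a S \<longleftrightarrow> ((\<lambda>m. norm (a m)) has_sum S) UNIV \<and> S \<le> B i \<and>
      (\<forall>t x. norm t \<le> 1 \<longrightarrow> norm x \<le> 1 \<longrightarrow>
        ((\<lambda>(n, l). a (n, l) * t ^ n * x ^ l) has_sum f i t x) UNIV)" for i a S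
  have "\<forall>i\<in>I. \<exists>a S. P i a S"
    using f unfolding wiener_def P_def by blast
  then obtain a S where "\<forall>i\<in>I. P i (a i) (S i)"
    by metis
  then have a: "\<And>i. i \<in> I \<Longrightarrow> ((\<lambda>m. norm (a i m)) has_sum S i) UNIV"
      and SB: "\<And>i. i \<in> I \<Longrightarrow> S i \<le> B i"
      and fa: "\<And>i t x. i \<in> I \<Longrightarrow> norm t \<le> 1 \<Longrightarrow> norm x \<le> 1 \<Longrightarrow>
        ((\<lambda>(n, l). a i (n, l) * t ^ n * x ^ l) has_sum f i t x) UNIV"
    by (auto simp: P_def)
  have S0: "0 \<le> S i" if "i \<in> I" for i
    using has_sum_nonneg[OF a[OF that]] by simp
  have "S summable_on I"
    by (rule summable_on_comparison_test[OF has_sum_imp_summable[OF B]]) (auto simp: SB S0)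
  then obtain S' where S': "(S has_sum S') I"
    by (auto simp: summable_on_def)
  have sa: "(\<lambda>z. norm (a (fst z) (snd z))) summable_on (I \<times> UNIV)"
    by (rule summable_on_SigmaI[where g = S]) (use a S' in \<open>auto simp: has_sum_imp_summable\<close>)
  show ?thesis
  proof (rule wienerI)
    show "((\<lambda>z. norm (a (fst z) (snd z))) has_sum S') (I \<times> UNIV)"
      by (rule has_sum_SigmaI[where g = S]) (use a S' sa in auto)
    show "S' \<le> C"
      by (rule has_sum_mono[OF S' B SB])
    fix t x :: complex assume tx: "norm t \<le> 1" "norm x \<le> 1"
    show "((\<lambda>z. a (fst z) (snd z) * t ^ fst (snd z) * x ^ snd (snd z)) has_sum g t x) (I \<times> UNIV)"
    proof (rule has_sum_SigmaI[where g = "\<lambda>i. f i t x"])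
      show "((\<lambda>y. a (fst (i, y)) (snd (i, y)) * t ^ fst (snd (i, y)) * x ^ snd (snd (i, y)))
          has_sum f i t x) UNIV" if "i \<in> I" for i
        using fa[OF that tx] by (simp add: case_prod_unfold)
      show "((\<lambda>i. f i t x) has_sum g t x) I"
        by (rule g[OF tx])
      show "(\<lambda>z. a (fst z) (snd z) * t ^ fst (snd z) * x ^ snd (snd z)) summable_on (I \<times> UNIV)"
        by (rule abs_summable_summable[OF Infinite_Sum.abs_summable_on_comparison_test'[OF sa]])
          (auto intro: norm_monom_le tx)
    qed
  qed
qed

lemma wiener_add:
  assumes "wiener f B" "wiener g C"
  shows "wiener (\<lambda>t x. f t x + g t x) (B + C)"
  by (rule wiener_has_sum[where I = "{0, 1::nat}" and f = "\<lambda>i. if i = 0 then f else g"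
        and B = "\<lambda>i. if i = 0 then B else C"])
    (use assms in \<open>auto intro!: has_sum_finiteI\<close>)

lemma wiener_monom_mult:
  assumes "wiener f B"
  shows "wiener (\<lambda>t x. c * t ^ p * x ^ q * f t x) (norm c * B)"
proof -
  obtain a S where a: "((\<lambda>i. norm (a i)) has_sum S) UNIV" "S \<le> B"
      "\<And>t x. norm t \<le> 1 \<Longrightarrow> norm x \<le> 1 \<Longrightarrow>
        ((\<lambda>(n, l). a (n, l) * t ^ n * x ^ l) has_sum f t x) UNIV"
    using assms unfolding wiener_def by blast
  show ?thesis
  proof (rule wienerI[where a = "\<lambda>i. c * a i" and I = UNIV and p = "\<lambda>i. fst i + p" and q = "\<lambda>i. snd i + q"])
    show "((\<lambda>i. norm (c * a i)) has_sum norm c * S) UNIV"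
      unfolding norm_mult by (rule has_sum_cmult_right[OF a(1)])
    show "norm c * S \<le> norm c * B"
      using a(2) by (simp add: mult_left_mono)
    fix t x :: complex assume "norm t \<le> 1" "norm x \<le> 1"
    from has_sum_cmult_right[OF a(3)[OF this], of "c * t ^ p * x ^ q"]
    show "((\<lambda>i. c * a i * t ^ (fst i + p) * x ^ (snd i + q)) has_sum c * t ^ p * x ^ q * f t x) UNIV"
      by (simp add: case_prod_unfold power_add mult_ac)
  qed
qed

lemma wiener_const: "wiener (\<lambda>t x. c) (norm c)"
  by (rule wienerI[where a = "\<lambda>_. c" and I = "{()}" and p = "\<lambda>_. 0" and q = "\<lambda>_. 0"]) (auto intro!: has_sum_finiteI)

text \<open>Only the first factor is expanded. The product becomes a sum of shifted multiples of
  \<open>g\<close>, so that no Cauchy product of two double series has to be formed.\<close>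

lemma wiener_mult:
  assumes f: "wiener f B" and g: "wiener g C"
  shows "wiener (\<lambda>t x. f t x * g t x) (B * C)"
proof -
  obtain a S where a: "((\<lambda>i. norm (a i)) has_sum S) UNIV" "S \<le> B"
      "\<And>t x. norm t \<le> 1 \<Longrightarrow> norm x \<le> 1 \<Longrightarrow>
        ((\<lambda>(n, l). a (n, l) * t ^ n * x ^ l) has_sum f t x) UNIV"
    using f unfolding wiener_def by blast
  have "wiener (\<lambda>t x. f t x * g t x) (S * C)"
  proof (rule wiener_has_sum)
    show "wiener (\<lambda>t x. a i * t ^ fst i * x ^ snd i * g t x) (norm (a i) * C)" for i
      by (rule wiener_monom_mult[OF g])
    show "((\<lambda>i. norm (a i) * C) has_sum S * C) UNIV"
      by (rule has_sum_cmult_left[OF a(1)])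
    fix t x :: complex assume "norm t \<le> 1" "norm x \<le> 1"
    from has_sum_cmult_left[OF a(3)[OF this], of "g t x"]
    show "((\<lambda>i. a i * t ^ fst i * x ^ snd i * g t x) has_sum f t x * g t x) UNIV"
      by (simp add: case_prod_unfold)
  qed
  then show ?thesis
    by (rule wiener_mono) (use a(2) wiener_nonneg[OF g] in \<open>simp add: mult_right_mono\<close>)
qed

lemma wiener_power:
  assumes "wiener f 1"
  shows "wiener (\<lambda>t x. f t x ^ n) 1"
proof (induction n)
  case 0
  show ?case using wiener_const[of 1] by simp
next
  case (Suc n)
  show ?case using wiener_mult[OF assms Suc] by simp
qed

text \<open>Induction through f^(n+1) - g^(n+1) = f (f^n - g^n) + (f - g) g^n. The factor
  \<open>real n\<close> is what the weight in \<open>small_series\<close> absorbs later.\<close>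

lemma wiener_power_diff:
  assumes "wiener f 1" "wiener g 1" and d: "wiener (\<lambda>t x. f t x - g t x) d"
  shows "wiener (\<lambda>t x. f t x ^ n - g t x ^ n) (real n * d)"
proof (induction n)
  case 0
  show ?case using wiener_const[of 0] by simp
next
  case (Suc n)
  have "wiener (\<lambda>t x. f t x * (f t x ^ n - g t x ^ n) + (f t x - g t x) * g t x ^ n)
      (1 * (real n * d) + d * 1)"
    by (intro wiener_add wiener_mult wiener_power assms Suc)
  then show ?case
    by (simp add: algebra_simps)
qed

section \<open>Inverting the linear part\<close>

text \<open>Weierstrass's theorem for unordered sums: the majorant \<open>M\<close> makes the finite
  partial sums converge uniformly on \<open>A\<close>, whence a holomorphic limit and termwise
  differentiation.\<close>

lemma has_sum_deriv:
  fixes f :: "'i \<Rightarrow> complex \<Rightarrow> complex"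
  assumes hol: "\<And>i. i \<in> I \<Longrightarrow> f i holomorphic_on A" and A: "open A"
    and le: "\<And>i z. i \<in> I \<Longrightarrow> z \<in> A \<Longrightarrow> norm (f i z) \<le> M i" and M: "M summable_on I"
    and g: "\<And>z. z \<in> A \<Longrightarrow> ((\<lambda>i. f i z) has_sum g z) I"
  shows "g holomorphic_on A"
    and "z \<in> A \<Longrightarrow> ((\<lambda>i. deriv (f i) z) has_sum deriv g z) I"
proof -
  have lim: "uniform_limit A (\<lambda>X z. \<Sum>i\<in>X. f i z) g (finite_subsets_at_top I)"
    by (rule Weierstrass_m_test_general'[OF le g M])
  have fin: "\<forall>\<^sub>F X in finite_subsets_at_top I. finite X \<and> X \<subseteq> I"
    by (rule eventually_finite_subsets_at_top_weakI) simp
  have hol': "\<forall>\<^sub>F X in finite_subsets_at_top I. (\<lambda>z. \<Sum>i\<in>X. f i z) holomorphic_on A"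
    using fin by eventually_elim (auto intro!: holomorphic_intros hol)
  have "\<exists>g'. (g has_field_derivative g') (at z)" if z: "z \<in> A" for z
  proof -
    obtain r where r: "r > 0" "cball z r \<subseteq> A"
      using A z open_contains_cball by blast
    have "ball z r \<subseteq> A" using r ball_subset_cball by blast
    have "g holomorphic_on ball z r"
    proof (rule holomorphic_uniform_limit)
      show "\<forall>\<^sub>F X in finite_subsets_at_top I. continuous_on (cball z r) (\<lambda>z. \<Sum>i\<in>X. f i z) \<and>
          (\<lambda>z. \<Sum>i\<in>X. f i z) holomorphic_on ball z r"
        using hol' by eventually_elim
          (use r \<open>ball z r \<subseteq> A\<close> in \<open>auto intro: holomorphic_on_imp_continuous_on holomorphic_on_subset\<close>)
      show "uniform_limit (cball z r) (\<lambda>X z. \<Sum>i\<in>X. f i z) g (finite_subsets_at_top I)"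
        by (rule uniform_limit_on_subset[OF lim r(2)])
    qed auto
    then show ?thesis
      using r by (auto simp: holomorphic_on_open)
  qed
  then show "g holomorphic_on A"
    using A by (simp add: holomorphic_on_open)
  assume z: "z \<in> A"
  have "((\<lambda>X. deriv (\<lambda>z. \<Sum>i\<in>X. f i z) z) \<longlongrightarrow> deriv g z) (finite_subsets_at_top I)"
    by (rule deriv_complex_uniform_limit[OF lim hol' _ A z]) auto
  then show "((\<lambda>i. deriv (f i) z) has_sum deriv g z) I"
    unfolding has_sum_def
  proof (rule Lim_transform_eventually)
    show "\<forall>\<^sub>F X in finite_subsets_at_top I. deriv (\<lambda>z. \<Sum>i\<in>X. f i z) z = (\<Sum>i\<in>X. deriv (f i) z)"
      using fin
    proof eventually_elim
      case (elim X)
      have "f i field_differentiable at z" if "i \<in> X" for i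
        using hol[of i] elim that z A holomorphic_on_imp_differentiable_at by blast
      then have "((\<lambda>z. \<Sum>i\<in>X. f i z) has_field_derivative (\<Sum>i\<in>X. deriv (f i) z)) (at z)"
        by (intro DERIV_sum) (simp add: field_differentiable_derivI)
      then show ?case by (rule DERIV_imp_deriv)
    qed
  qed
qed

lemma
  assumes "wiener f B"
  shows wiener_continuous: "continuous_on (cball 0 1 \<times> cball 0 1) (\<lambda>(t, x). f t x)"
    and wiener_holomorphic_fst: "norm x \<le> 1 \<Longrightarrow> (\<lambda>t. f t x) holomorphic_on ball 0 1"
    and wiener_holomorphic_snd: "norm t \<le> 1 \<Longrightarrow> f t holomorphic_on ball 0 1"
proof -
  obtain a S where a: "((\<lambda>i. norm (a i)) has_sum S) UNIV"
      and fa: "\<And>t x. norm t \<le> 1 \<Longrightarrow> norm x \<le> 1 \<Longrightarrow>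
        ((\<lambda>i. a i * t ^ fst i * x ^ snd i) has_sum f t x) UNIV"
    using assms unfolding wiener_def by (auto simp: case_prod_unfold)
  note M = has_sum_imp_summable[OF a]
  have "uniform_limit (cball 0 1 \<times> cball 0 1) (\<lambda>X z. \<Sum>i\<in>X. a i * fst z ^ fst i * snd z ^ snd i)
      (\<lambda>(t, x). f t x) (finite_subsets_at_top UNIV)"
    by (rule Weierstrass_m_test_general'[OF _ _ M]) (auto intro!: norm_monom_le fa)
  then show "continuous_on (cball 0 1 \<times> cball 0 1) (\<lambda>(t, x). f t x)"
    by (rule uniform_limit_theorem[rotated]) (auto intro!: continuous_intros)
  show "(\<lambda>t. f t x) holomorphic_on ball 0 1" if "norm x \<le> 1"
    by (rule has_sum_deriv(1)[OF _ _ _ M fa]) (use that in \<open>auto intro!: holomorphic_intros norm_monom_le\<close>)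
  show "f t holomorphic_on ball 0 1" if "norm t \<le> 1"
    by (rule has_sum_deriv(1)[OF _ _ _ M fa]) (use that in \<open>auto intro!: holomorphic_intros norm_monom_le\<close>)
qed

text \<open>Coefficientwise division by \<open>D\<close>. As n \<ge> 0, the real part alone shows |n
  - lam - c l| \<ge> \<delta> (1 + l), so there are no resonances. The series \<open>v\<close> obeys
  the same bound as \<open>e\<close> on the same closed bidisc, although it is claimed to be the
  x-derivative only for |x| < 1.\<close>

lemma wiener_solve:
  fixes lam c :: complex
  assumes f: "wiener f B" and \<delta>: "\<delta> > 0" and lam: "Re lam \<le> - \<delta>" and c: "Re c \<le> - \<delta>"
  obtains e v where "wiener e (B / \<delta>)" "wiener v (B / \<delta>)"
    "\<And>t x. norm t \<le> 1 \<Longrightarrow> norm x < 1 \<Longrightarrow> (e t has_field_derivative v t x) (at x)"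
    "\<And>t x. norm t < 1 \<Longrightarrow> norm x < 1 \<Longrightarrow>
      t * deriv (\<lambda>s. e s x) t = lam * e t x + c * x * v t x + f t x"
proof -
  obtain a S where a: "((\<lambda>i. norm (a i)) has_sum S) UNIV" and SB: "S \<le> B"
      and fa: "\<And>t x. norm t \<le> 1 \<Longrightarrow> norm x \<le> 1 \<Longrightarrow>
        ((\<lambda>i. a i * t ^ fst i * x ^ snd i) has_sum f t x) UNIV"
    using f unfolding wiener_def by (auto simp: case_prod_unfold)
  define D where "D i = of_nat (fst i) - lam - c * of_nat (snd i)" for i :: "nat \<times> nat"
  have D: "\<delta> * (1 + real (snd i)) \<le> norm (D i)" for i
  proof -
    have "Re c * real (snd i) \<le> - \<delta> * real (snd i)"
      by (rule mult_right_mono[OF c]) simp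
    then have "\<delta> * (1 + real (snd i)) \<le> Re (D i)"
      using lam \<delta> by (simp add: D_def algebra_simps)
    then show ?thesis
      using complex_Re_le_cmod order_trans by blast
  qed
  have D0: "D i \<noteq> 0" for i
    using D[of i] \<delta> by (auto simp: mult_le_0_iff)
  define b where "b i = a i / D i" for i
  have lb: "norm (b i) * (1 + real (snd i)) \<le> norm (a i) / \<delta>" for i
  proof -
    have "norm (b i) * (\<delta> * (1 + real (snd i))) \<le> norm (b i) * norm (D i)"
      by (rule mult_left_mono[OF D]) simp
    also have "\<dots> = norm (a i)"
      using D0[of i] by (simp add: b_def norm_divide)
    finally show ?thesis
      using \<delta> by (simp add: field_simps)
  qed
  have b1: "norm (b i) \<le> norm (a i) / \<delta>" for i
    by (rule order_trans[OF _ lb[of i]]) (simp add: algebra_simps)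
  have b2: "norm (of_nat (snd i) * b i) \<le> norm (a i) / \<delta>" for i
    by (rule order_trans[OF _ lb[of i]]) (simp add: norm_mult algebra_simps)
  have M: "((\<lambda>i. norm (a i) / \<delta>) has_sum S / \<delta>) UNIV"
    using has_sum_cmult_left[OF a, of "1 / \<delta>"] by simp
  note Ms = has_sum_imp_summable[OF M]
  \<comment> \<open>The exponent of x is left free so that \<open>e\<close>, with exponent l, and
    \<open>v\<close>, with exponent l - 1, are treated alike.\<close>
  have wI: "wiener g (B / \<delta>)"
    if le: "\<And>i. norm (d i) \<le> norm (a i) / \<delta>"
      and g: "\<And>t x. norm t \<le> 1 \<Longrightarrow> norm x \<le> 1 \<Longrightarrow>
        ((\<lambda>i. d i * t ^ fst i * x ^ q i) has_sum g t x) UNIV" for d q g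
  proof -
    have "(\<lambda>i. norm (d i)) summable_on UNIV"
      by (rule Infinite_Sum.abs_summable_on_comparison_test'[OF Ms le])
    then obtain S' where S': "((\<lambda>i. norm (d i)) has_sum S') UNIV"
      by (auto simp: summable_on_def)
    have "S' \<le> S / \<delta>"
      by (rule has_sum_mono[OF S' M le])
    also have "\<dots> \<le> B / \<delta>"
      using SB \<delta> by (simp add: divide_right_mono)
    finally show ?thesis
      by (rule wienerI[OF S']) (rule g)
  qed
  have sumI: "((\<lambda>i. d i * t ^ fst i * x ^ q i) has_sum (\<Sum>\<^sub>\<infinity>i. d i * t ^ fst i * x ^ q i)) UNIV"
    if "\<And>i. norm (d i) \<le> norm (a i) / \<delta>" "norm t \<le> 1" "norm x \<le> 1" for d q and t x :: complex
  proof (rule has_sum_infsum, rule abs_summable_summable)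
    show "(\<lambda>i. norm (d i * t ^ fst i * x ^ q i)) summable_on UNIV"
      by (rule Infinite_Sum.abs_summable_on_comparison_test'[OF Ms])
        (rule order_trans[OF norm_monom_le], use that in auto)
  qed
  define e where "e t x = (\<Sum>\<^sub>\<infinity>i. b i * t ^ fst i * x ^ snd i)" for t x
  \<comment> \<open>For l = 0 the exponent is truncated to 0, but the factor l kills the term. The
    indices with l = 0 and l = 1 thus share an exponent, which \<open>wienerI\<close>
    permits.\<close>
  define v where "v t x = (\<Sum>\<^sub>\<infinity>i. (of_nat (snd i) * b i) * t ^ fst i * x ^ (snd i - 1))" for t x
  have esum: "((\<lambda>i. b i * t ^ fst i * x ^ snd i) has_sum e t x) UNIV"
    if "norm t \<le> 1" "norm x \<le> 1" for t x
    unfolding e_def by (rule sumI[OF b1 that])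
  have vsum: "((\<lambda>i. (of_nat (snd i) * b i) * t ^ fst i * x ^ (snd i - 1)) has_sum v t x) UNIV"
    if "norm t \<le> 1" "norm x \<le> 1" for t x
    unfolding v_def by (rule sumI[OF b2 that])
  have we: "wiener e (B / \<delta>)"
    by (rule wI[OF b1 esum])
  have wv: "wiener v (B / \<delta>)"
    by (rule wI[OF b2 vsum])
  have le: "norm (b i * t ^ fst i * x ^ snd i) \<le> norm (a i) / \<delta>"
    if "norm t \<le> 1" "norm x \<le> 1" for i t x
    by (rule order_trans[OF norm_monom_le b1]) (use that in auto)
  have ev: "(e t has_field_derivative v t x) (at x)" if "norm t \<le> 1" "norm x < 1" for t x
  proof -
    have "((\<lambda>i. deriv (\<lambda>x. b i * t ^ fst i * x ^ snd i) x) has_sum deriv (e t) x) UNIV"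
      by (rule has_sum_deriv(2)[where A = "ball 0 1", OF _ _ le Ms esum])
        (use that in \<open>auto intro!: holomorphic_intros\<close>)
    moreover have "deriv (\<lambda>x. b i * t ^ fst i * x ^ snd i) x =
        (of_nat (snd i) * b i) * t ^ fst i * x ^ (snd i - 1)" for i
      by (auto intro!: DERIV_imp_deriv derivative_eq_intros)
    ultimately have "deriv (e t) x = v t x"
      using vsum[of t x] that by (simp add: has_sum_unique)
    moreover have "e t holomorphic_on ball 0 1"
      using wiener_holomorphic_snd[OF we] that by simp
    ultimately show ?thesis
      using that holomorphic_derivI[of "e t" "ball 0 1" x] by simp
  qed
  \<comment> \<open>Both sides are sums of the family n b t^n x^l: the left one by termwise
    differentiation in t, the right one because b = a / D says that n b = lam b + c l b + a.\<close>
  have "t * deriv (\<lambda>s. e s x) t = lam * e t x + c * x * v t x + f t x"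
    if "norm t < 1" "norm x < 1" for t x
  proof (rule has_sum_unique)
    have "((\<lambda>i. deriv (\<lambda>t. b i * t ^ fst i * x ^ snd i) t) has_sum deriv (\<lambda>s. e s x) t) UNIV"
      by (rule has_sum_deriv(2)[where A = "ball 0 1", OF _ _ le Ms esum])
        (use that in \<open>auto intro!: holomorphic_intros\<close>)
    moreover have "deriv (\<lambda>t. b i * t ^ fst i * x ^ snd i) t =
        b i * (of_nat (fst i) * t ^ (fst i - 1)) * x ^ snd i" for i
      by (auto intro!: DERIV_imp_deriv derivative_eq_intros)
    ultimately have "((\<lambda>i. t * (b i * (of_nat (fst i) * t ^ (fst i - 1)) * x ^ snd i)) has_sum
        t * deriv (\<lambda>s. e s x) t) UNIV"
      by (intro has_sum_cmult_right) simp
    then show "((\<lambda>i. of_nat (fst i) * (b i * t ^ fst i * x ^ snd i)) has_sum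
        t * deriv (\<lambda>s. e s x) t) UNIV"
    proof (rule has_sum_cong[THEN iffD1, rotated])
      show "t * (b i * (of_nat (fst i) * t ^ (fst i - 1)) * x ^ snd i) =
          of_nat (fst i) * (b i * t ^ fst i * x ^ snd i)" for i
        by (cases "fst i") auto
    qed
    have "((\<lambda>i. lam * (b i * t ^ fst i * x ^ snd i) +
        c * x * ((of_nat (snd i) * b i) * t ^ fst i * x ^ (snd i - 1)) +
        a i * t ^ fst i * x ^ snd i) has_sum lam * e t x + c * x * v t x + f t x) UNIV"
      by (intro has_sum_add has_sum_cmult_right esum vsum fa) (use that in auto)
    then show "((\<lambda>i. of_nat (fst i) * (b i * t ^ fst i * x ^ snd i)) has_sum
        lam * e t x + c * x * v t x + f t x) UNIV"
    proof (rule has_sum_cong[THEN iffD1, rotated])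
      fix i :: "nat \<times> nat"
      have x: "x * (of_nat (snd i) * x ^ (snd i - 1)) = of_nat (snd i) * x ^ snd i"
        by (cases "snd i") auto
      have "a i = (of_nat (fst i) - lam - c * of_nat (snd i)) * b i"
        using D0[of i] by (simp add: b_def D_def)
      then have ab: "lam * b i + c * of_nat (snd i) * b i + a i = of_nat (fst i) * b i"
        by (simp add: algebra_simps)
      have "lam * (b i * t ^ fst i * x ^ snd i) +
          c * b i * t ^ fst i * (of_nat (snd i) * x ^ snd i) + a i * t ^ fst i * x ^ snd i =
          (lam * b i + c * of_nat (snd i) * b i + a i) * (t ^ fst i * x ^ snd i)"
        by (simp add: algebra_simps)
      also have "\<dots> = of_nat (fst i) * (b i * t ^ fst i * x ^ snd i)"
        unfolding ab by (simp add: mult_ac)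
      finally have "lam * (b i * t ^ fst i * x ^ snd i) +
          c * b i * t ^ fst i * (of_nat (snd i) * x ^ snd i) + a i * t ^ fst i * x ^ snd i =
          of_nat (fst i) * (b i * t ^ fst i * x ^ snd i)" .
      then show "lam * (b i * t ^ fst i * x ^ snd i) +
          c * x * ((of_nat (snd i) * b i) * t ^ fst i * x ^ (snd i - 1)) +
          a i * t ^ fst i * x ^ snd i = of_nat (fst i) * (b i * t ^ fst i * x ^ snd i)"
        unfolding x[symmetric] by (simp add: algebra_simps)
    qed
  qed
  then show ?thesis
    using that we wv ev by blast
qed

section \<open>Power series in four variables\<close>

definition taylor_coeff :: "(complex \<Rightarrow> complex) \<Rightarrow> nat \<Rightarrow> complex"
  where "taylor_coeff f n = (deriv ^^ n) f 0 / fact n"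

lemma taylor_coeff_bound:
  assumes hol: "f holomorphic_on ball 0 r" and M: "\<And>z. norm z < r \<Longrightarrow> norm (f z) \<le> M"
    and \<rho>: "0 < \<rho>" "\<rho> < r"
  shows "norm (taylor_coeff f n) \<le> M / \<rho> ^ n"
proof -
  have "norm ((deriv ^^ n) f 0) \<le> fact n * M / \<rho> ^ n"
    by (rule Cauchy_inequality)
      (use \<rho> M hol in \<open>auto intro!: holomorphic_on_imp_continuous_on elim!: holomorphic_on_subset\<close>)
  then show ?thesis
    by (simp add: taylor_coeff_def norm_divide field_simps)
qed

lemma taylor_coeff_has_sum:
  assumes hol: "f holomorphic_on ball 0 r" and M: "\<And>z. norm z < r \<Longrightarrow> norm (f z) \<le> M"
    and z: "norm z < r"
  shows "((\<lambda>n. taylor_coeff f n * z ^ n) has_sum f z) UNIV"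
proof (rule norm_summable_imp_has_sum)
  show "(\<lambda>n. taylor_coeff f n * z ^ n) sums f z"
    using holomorphic_power_series[OF hol, of z] z by (simp add: taylor_coeff_def)
  define \<rho> where "\<rho> = (norm z + r) / 2"
  have \<rho>: "0 < \<rho>" "\<rho> < r" "norm z < \<rho>"
    using z le_less_trans[OF norm_ge_zero z] by (auto simp: \<rho>_def intro: add_nonneg_pos)
  have "summable (\<lambda>n. M * (norm z / \<rho>) ^ n)"
    by (intro summable_mult summable_geometric) (use \<rho> in simp)
  then show "summable (\<lambda>n. norm (taylor_coeff f n * z ^ n))"
  proof (rule summable_comparison_test')
    show "norm (norm (taylor_coeff f n * z ^ n)) \<le> M * (norm z / \<rho>) ^ n" for n
      using mult_right_mono[OF taylor_coeff_bound[OF hol M \<rho>(1,2), of n], of "norm z ^ n"]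
      by (simp add: norm_mult norm_power power_divide)
  qed
qed

text \<open>Cauchy's bounds compare the tail with a geometric series of ratio |z| / \<rho> \<le>
  1/2, whose sum costs the factor 2.\<close>

lemma taylor_remainder:
  assumes hol: "f holomorphic_on ball 0 r" and M: "\<And>z. norm z < r \<Longrightarrow> norm (f z) \<le> M"
    and z: "norm z \<le> \<rho> / 2" and \<rho>: "0 < \<rho>" "\<rho> < r"
  shows "norm (f z - (\<Sum>i<n. taylor_coeff f i * z ^ i)) \<le> 2 * M * (norm z / \<rho>) ^ n"
proof -
  have zr: "norm z < r" using z \<rho> by simp
  define q where "q = norm z / \<rho>"
  have q: "0 \<le> q" "q \<le> 1 / 2" using z \<rho> by (simp_all add: q_def field_simps)
  have M0: "0 \<le> M" using order_trans[OF norm_ge_zero M[of 0]] \<rho> by simp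
  have "(\<lambda>n. taylor_coeff f n * z ^ n) sums f z"
    using holomorphic_power_series[OF hol, of z] zr by (simp add: taylor_coeff_def)
  then have s: "(\<lambda>i. taylor_coeff f (i + n) * z ^ (i + n)) sums (f z - (\<Sum>i<n. taylor_coeff f i * z ^ i))"
    by (rule sums_split_initial_segment)
  have g: "(\<lambda>i. M * q ^ n * q ^ i) sums (M * q ^ n * (1 / (1 - q)))"
    by (intro sums_mult geometric_sums) (use q in simp)
  have "norm (taylor_coeff f (i + n) * z ^ (i + n)) \<le> M * q ^ n * q ^ i" for i
    using mult_right_mono[OF taylor_coeff_bound[OF hol M \<rho>, of "i + n"], of "norm z ^ (i + n)"]
    by (simp add: norm_mult norm_power power_divide power_add q_def mult_ac)
  then have "norm (f z - (\<Sum>i<n. taylor_coeff f i * z ^ i)) \<le> M * q ^ n * (1 / (1 - q))"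
    using norm_suminf_le[of "\<lambda>i. taylor_coeff f (i + n) * z ^ (i + n)" "\<lambda>i. M * q ^ n * q ^ i"] s g
    by (simp add: sums_iff)
  also have "\<dots> \<le> M * q ^ n * 2"
    by (rule mult_left_mono) (use q M0 in \<open>auto simp: field_simps\<close>)
  finally show ?thesis by (simp add: q_def)
qed

text \<open>No integral with a parameter is involved: the n-th coefficient is the limit, as s tends
  to 0, of \<open>f s y\<close> minus its earlier Taylor terms, divided by s^n. These quotients are
  holomorphic in y by induction, and \<open>taylor_remainder\<close> bounds their error by a
  multiple of s, uniformly in y.\<close>

lemma taylor_coeff_param_holomorphic:
  fixes f :: "complex \<Rightarrow> complex \<Rightarrow> complex"
  assumes hol1: "\<And>y. y \<in> U \<Longrightarrow> (\<lambda>t. f t y) holomorphic_on ball 0 r"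
    and hol2: "\<And>t. norm t < r \<Longrightarrow> f t holomorphic_on U"
    and M: "\<And>t y. norm t < r \<Longrightarrow> y \<in> U \<Longrightarrow> norm (f t y) \<le> M"
    and U: "open U" and r: "0 < r"
  shows "(\<lambda>y. taylor_coeff (\<lambda>t. f t y) n) holomorphic_on U"
proof (induction n rule: less_induct)
  case (less n)
  define \<rho> where "\<rho> = r / 2"
  have \<rho>: "0 < \<rho>" "\<rho> < r" using r by (simp_all add: \<rho>_def)
  \<comment> \<open>Any positive null sequence below \<open>\<rho> / 2\<close> would do;
    \<open>taylor_remainder\<close> asks for that bound.\<close>
  define s where "s m = \<rho> / 2 * (1 / 2) ^ m" for m :: nat
  have s: "0 < s m" "s m \<le> \<rho> / 2" for m
    using \<rho> by (simp_all add: s_def power_le_one)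
  define g where "g m y = (f (of_real (s m)) y - (\<Sum>i<n. taylor_coeff (\<lambda>t. f t y) i * of_real (s m) ^ i)) /
      of_real (s m) ^ n" for m y
  have sr: "norm (of_real (s m) :: complex) < r" for m
    using s[of m] \<rho> by simp
  have lim: "uniform_limit U g (\<lambda>y. taylor_coeff (\<lambda>t. f t y) n) sequentially"
  proof (rule uniform_limitI)
    fix e :: real assume e: "e > 0"
    have "(\<lambda>m. 2 * M * (s m / \<rho> ^ Suc n)) \<longlonglongrightarrow> 2 * M * (\<rho> / 2 * 0 / \<rho> ^ Suc n)"
      unfolding s_def by (intro tendsto_intros LIMSEQ_power_zero) (use \<rho> in auto)
    then have "\<forall>\<^sub>F m in sequentially. 2 * M * (s m / \<rho> ^ Suc n) < e"
      using e by (intro order_tendstoD) auto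
    then show "\<forall>\<^sub>F m in sequentially. \<forall>y\<in>U. dist (g m y) (taylor_coeff (\<lambda>t. f t y) n) < e"
    proof eventually_elim
      case (elim m)
      show ?case
      proof
        fix y assume y: "y \<in> U"
        have "norm (f (of_real (s m)) y - (\<Sum>i<Suc n. taylor_coeff (\<lambda>t. f t y) i * of_real (s m) ^ i))
            \<le> 2 * M * (norm (of_real (s m) :: complex) / \<rho>) ^ Suc n"
          by (rule taylor_remainder[OF hol1[OF y] _ _ \<rho>]) (use M y s[of m] in auto)
        moreover have "g m y - taylor_coeff (\<lambda>t. f t y) n =
            (f (of_real (s m)) y - (\<Sum>i<Suc n. taylor_coeff (\<lambda>t. f t y) i * of_real (s m) ^ i)) / of_real (s m) ^ n"
          using s(1)[of m] \<rho>(1) by (simp add: g_def field_simps)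
        ultimately have "norm (g m y - taylor_coeff (\<lambda>t. f t y) n) \<le>
            2 * M * (s m / \<rho>) ^ Suc n / s m ^ n"
          using s(1)[of m] by (simp only: norm_divide norm_power norm_of_real abs_of_pos divide_right_mono
              zero_le_power less_imp_le)
        also have "\<dots> = 2 * M * (s m / \<rho> ^ Suc n)"
          using less_imp_neq[OF s(1)[of m]] less_imp_neq[OF \<rho>(1)] by (simp add: power_divide)
        finally show "dist (g m y) (taylor_coeff (\<lambda>t. f t y) n) < e"
          using elim by (simp add: dist_norm)
      qed
    qed
  qed
  show ?case
  proof (rule holomorphic_uniform_sequence[OF U, of g])
    show "g m holomorphic_on U" for m
      unfolding g_def by (intro holomorphic_intros hol2 sr less) (use s[of m] in auto)
    fix y assume "y \<in> U"
    then obtain d where d: "d > 0" "cball y d \<subseteq> U"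
      using U open_contains_cball by blast
    then show "\<exists>d>0. cball y d \<subseteq> U \<and>
        uniform_limit (cball y d) g (\<lambda>y. taylor_coeff (\<lambda>t. f t y) n) sequentially"
      using uniform_limit_on_subset[OF lim] by blast
  qed
qed

text \<open>The weight \<open>1 + i + j\<close> makes \<open>\<epsilon>\<close> a Lipschitz constant in the last two arguments.\<close>

definition small_series :: "(complex \<Rightarrow> complex \<Rightarrow> complex \<Rightarrow> complex \<Rightarrow> complex) \<Rightarrow> real \<Rightarrow> bool"
  where "small_series K \<epsilon> \<longleftrightarrow>
    (\<exists>k S. ((\<lambda>(p, q, i, j). norm (k p q i j) * (1 + real i + real j)) has_sum S) UNIV \<and> S \<le> \<epsilon> \<and>
      (\<forall>t x y z. norm t \<le> 1 \<longrightarrow> norm x \<le> 1 \<longrightarrow> norm y \<le> 1 \<longrightarrow> norm z \<le> 1 \<longrightarrow>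
        ((\<lambda>(p, q, i, j). k p q i j * t ^ p * x ^ q * (y ^ i * z ^ j)) has_sum K t x y z) UNIV))"

lemma small_series_wiener:
  assumes K: "small_series K \<epsilon>" and y: "wiener y 1" and z: "wiener z 1"
  shows "wiener (\<lambda>t x. K t x (y t x) (z t x)) \<epsilon>"
proof -
  obtain k S where k: "((\<lambda>(p, q, i, j). norm (k p q i j) * (1 + real i + real j)) has_sum S) UNIV" "S \<le> \<epsilon>"
     and Kk: "\<And>t x y z. norm t \<le> 1 \<Longrightarrow> norm x \<le> 1 \<Longrightarrow> norm y \<le> 1 \<Longrightarrow> norm z \<le> 1 \<Longrightarrow>
        ((\<lambda>(p, q, i, j). k p q i j * t ^ p * x ^ q * (y ^ i * z ^ j)) has_sum K t x y z) UNIV"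
    using K unfolding small_series_def by blast
  have "wiener (\<lambda>t x. K t x (y t x) (z t x)) S"
  proof (rule wiener_has_sum[OF _ k(1)])
    fix m :: "nat \<times> nat \<times> nat \<times> nat"
    obtain p q i j where m: "m = (p, q, i, j)" by (cases m) auto
    have "wiener (\<lambda>t x. k p q i j * t ^ p * x ^ q * (y t x ^ i * z t x ^ j)) (norm (k p q i j) * (1 * 1))"
      by (intro wiener_monom_mult wiener_mult wiener_power y z)
    then show "wiener ((\<lambda>(p, q, i, j) t x. k p q i j * t ^ p * x ^ q * (y t x ^ i * z t x ^ j)) m)
        (case m of (p, q, i, j) \<Rightarrow> norm (k p q i j) * (1 + real i + real j))"
      unfolding m prod.case by (rule wiener_mono) (simp add: mult_left_mono algebra_simps)
  next
    fix t x :: complex assume tx: "norm t \<le> 1" "norm x \<le> 1"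
    then show "((\<lambda>m. (\<lambda>(p, q, i, j) t x. k p q i j * t ^ p * x ^ q * (y t x ^ i * z t x ^ j)) m t x)
        has_sum K t x (y t x) (z t x)) UNIV"
      using Kk[OF tx wiener_norm_le[OF y tx] wiener_norm_le[OF z tx]] by (simp add: case_prod_unfold)
  qed
  then show ?thesis
    using k(2) wiener_mono by blast
qed

text \<open>Passing from y^i z^j to y'^i z'^j through y'^i z^j costs at most (i + j)
  \<open>d\<close>, and the weight in \<open>small_series\<close> pays for this factor.\<close>

lemma small_series_wiener_diff:
  assumes K: "small_series K \<epsilon>" and y: "wiener y 1" "wiener y' 1" and z: "wiener z 1" "wiener z' 1"
    and dy: "wiener (\<lambda>t x. y' t x - y t x) d" and dz: "wiener (\<lambda>t x. z' t x - z t x) d"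
  shows "wiener (\<lambda>t x. K t x (y' t x) (z' t x) - K t x (y t x) (z t x)) (\<epsilon> * d)"
proof -
  obtain k S where k: "((\<lambda>(p, q, i, j). norm (k p q i j) * (1 + real i + real j)) has_sum S) UNIV" "S \<le> \<epsilon>"
     and Kk: "\<And>t x y z. norm t \<le> 1 \<Longrightarrow> norm x \<le> 1 \<Longrightarrow> norm y \<le> 1 \<Longrightarrow> norm z \<le> 1 \<Longrightarrow>
        ((\<lambda>(p, q, i, j). k p q i j * t ^ p * x ^ q * (y ^ i * z ^ j)) has_sum K t x y z) UNIV"
    using K unfolding small_series_def by blast
  note d0 = wiener_nonneg[OF dy]
  define G where "G i j t x = y' t x ^ i * z' t x ^ j - y t x ^ i * z t x ^ j" for i j t x
  have G: "wiener (G i j) ((1 + real i + real j) * d)" for i j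
  proof -
    have "wiener (\<lambda>t x. y' t x ^ i * (z' t x ^ j - z t x ^ j) + (y' t x ^ i - y t x ^ i) * z t x ^ j)
       (1 * (real j * d) + (real i * d) * 1)"
      by (intro wiener_add wiener_mult wiener_power wiener_power_diff y z dy dz)
    moreover have "(\<lambda>t x. y' t x ^ i * (z' t x ^ j - z t x ^ j) + (y' t x ^ i - y t x ^ i) * z t x ^ j) = G i j"
      by (simp add: fun_eq_iff G_def algebra_simps)
    ultimately show ?thesis
      by (rule_tac wiener_mono) (use d0 in \<open>auto simp: algebra_simps\<close>)
  qed
  have "wiener (\<lambda>t x. K t x (y' t x) (z' t x) - K t x (y t x) (z t x)) (S * d)"
  proof (rule wiener_has_sum[OF _ has_sum_cmult_left[OF k(1)]])
    fix m :: "nat \<times> nat \<times> nat \<times> nat"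
    obtain p q i j where m: "m = (p, q, i, j)" by (cases m) auto
    have "wiener (\<lambda>t x. k p q i j * t ^ p * x ^ q * G i j t x) (norm (k p q i j) * ((1 + real i + real j) * d))"
      by (intro wiener_monom_mult G)
    then show "wiener ((\<lambda>(p, q, i, j) t x. k p q i j * t ^ p * x ^ q * G i j t x) m)
        ((case m of (p, q, i, j) \<Rightarrow> norm (k p q i j) * (1 + real i + real j)) * d)"
      unfolding m prod.case by (simp add: mult.assoc)
  next
    fix t x :: complex assume tx: "norm t \<le> 1" "norm x \<le> 1"
    have "((\<lambda>m. (\<lambda>(p, q, i, j). k p q i j * t ^ p * x ^ q * (y' t x ^ i * z' t x ^ j)) m +
         - (\<lambda>(p, q, i, j). k p q i j * t ^ p * x ^ q * (y t x ^ i * z t x ^ j)) m)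
        has_sum K t x (y' t x) (z' t x) + - K t x (y t x) (z t x)) UNIV"
      by (intro has_sum_add has_sum_uminusI Kk tx wiener_norm_le[OF y(1) tx] wiener_norm_le[OF y(2) tx]
           wiener_norm_le[OF z(1) tx] wiener_norm_le[OF z(2) tx])
    then show "((\<lambda>m. (\<lambda>(p, q, i, j) t x. k p q i j * t ^ p * x ^ q * G i j t x) m t x)
        has_sum K t x (y' t x) (z' t x) - K t x (y t x) (z t x)) UNIV"
      by (simp add: case_prod_unfold G_def algebra_simps)
  qed
  then show ?thesis
    by (rule wiener_mono) (use k(2) d0 in \<open>simp add: mult_right_mono\<close>)
qed

text \<open>Constant functions belong to the algebra and turn its Lipschitz estimate into a
  pointwise one.\<close>

lemma small_series_lipschitz:
  assumes K: "small_series K \<epsilon>" and "norm t \<le> 1" "norm x \<le> 1"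
    "norm y \<le> 1" "norm y' \<le> 1" "norm z \<le> 1" "norm z' \<le> 1"
  shows "norm (K t x y' z' - K t x y z) \<le> \<epsilon> * max (norm (y' - y)) (norm (z' - z))"
  proof (rule wiener_norm_le[OF small_series_wiener_diff[OF K, of "\<lambda>_ _. y" "\<lambda>_ _. y'" "\<lambda>_ _. z" "\<lambda>_ _. z'"]])
  show "norm t \<le> 1" "norm x \<le> 1" by fact+
qed (rule wiener_mono[OF wiener_const], use assms in simp)+

text \<open>As 1 + i + j \<le> (1 + p) (1 + q) (1 + i) (1 + j), the family is dominated by a product
  of four copies of the convergent series of \<open>h\<close>.\<close>

lemma summable_majorant:
  "(\<lambda>(p, q, i, j). (1 / 2 :: real) ^ (p + q + i + j) * (1 + real i + real j)) summable_on UNIV"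
proof -
  define h where "h n = (1 / 2 :: real) ^ n * (1 + real n)" for n
  have h0: "0 \<le> h n" for n by (simp add: h_def)
  have "(\<lambda>n. of_nat (Suc n) * (1 / 2 :: real) ^ n) sums (1 / (1 - 1 / 2)\<^sup>2)"
    by (rule geometric_deriv_sums) simp
  then have "summable h"
    unfolding h_def by (simp add: sums_iff mult.commute algebra_simps)
  then obtain H where H: "(h has_sum H) UNIV"
    by (metis h0 sums_nonneg_imp_has_sum summable_def)
  note Hs = has_sum_imp_summable[OF H]
  have prod: "((\<lambda>m. f (fst m) * g (snd m)) has_sum F * G) UNIV"
    if f: "(f has_sum F) UNIV" "\<And>i. 0 \<le> f i" and g: "(g has_sum G) UNIV" "\<And>i. 0 \<le> g i"
    for f :: "nat \<Rightarrow> real" and g :: "'i \<Rightarrow> real" and F G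
  proof -
    have 1: "((\<lambda>y. f (fst (i, y)) * g (snd (i, y))) has_sum f i * G) UNIV" for i
      using has_sum_cmult_right[OF g(1), of "f i"] by simp
    have 2: "((\<lambda>i. f i * G) has_sum F * G) UNIV"
      by (rule has_sum_cmult_left[OF f(1)])
    have "((\<lambda>m. f (fst m) * g (snd m)) has_sum F * G) (UNIV \<times> UNIV)"
      by (rule has_sum_SigmaI[OF 1 2])
        (rule summable_on_SigmaI[OF 1], use 2 f g in \<open>auto simp: has_sum_imp_summable\<close>)
    then show ?thesis by simp
  qed
  note p2 = prod[OF H h0 H h0]
  note p3 = prod[OF H h0 p2]
  note p4 = prod[OF H h0 p3]
  have "(\<lambda>m. h (fst m) * (h (fst (snd m)) * (h (fst (snd (snd m))) * h (snd (snd (snd m)))))) summable_on UNIV"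
    by (rule has_sum_imp_summable[OF p4]) (simp_all add: h0)
  then show ?thesis
  proof (rule summable_on_comparison_test)
    fix m :: "nat \<times> nat \<times> nat \<times> nat"
    obtain p q i j where m: "m = (p, q, i, j)" by (cases m) auto
    have "1 + real i + real j \<le> (1 + real p) * ((1 + real q) * ((1 + real i) * (1 + real j)))"
    proof -
      have "1 + real i + real j \<le> (1 + real i) * (1 + real j)"
        by (simp add: algebra_simps)
      also have "\<dots> \<le> (1 + real q) * ((1 + real i) * (1 + real j))"
        using mult_right_mono[of 1 "1 + real q" "(1 + real i) * (1 + real j)"] by simp
      also have "\<dots> \<le> (1 + real p) * ((1 + real q) * ((1 + real i) * (1 + real j)))"
        using mult_right_mono[of 1 "1 + real p" "(1 + real q) * ((1 + real i) * (1 + real j))"] by simp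
      finally show ?thesis .
    qed
    from mult_left_mono[OF this, of "(1 / 2) ^ (p + q + i + j)"]
    show "(case m of (p, q, i, j) \<Rightarrow> (1 / 2 :: real) ^ (p + q + i + j) * (1 + real i + real j)) \<le>
        h (fst m) * (h (fst (snd m)) * (h (fst (snd (snd m))) * h (snd (snd (snd m)))))"
      unfolding m by (simp add: h_def power_add mult_ac)
  qed auto
qed

definition majorant_const :: real
  where "majorant_const =
    (\<Sum>\<^sub>\<infinity>(p, q, i, j). (1 / 2) ^ (p + q + i + j) * (1 + real i + real j))"

lemma majorant_const_nonneg: "0 \<le> majorant_const"
  unfolding majorant_const_def by (rule infsum_nonneg) auto

text \<open>Cauchy's estimate on radius 2, between the 1 of the expansion and the 3 of the
  hypotheses, bounds the coefficients by M 2^-(p+q+i+j). As \<open>majorant_const\<close> does not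
  depend on \<open>K\<close>, a small sup on the larger polydisc yields a small weighted
  series.\<close>

lemma small_seriesI:
  fixes K :: "complex \<Rightarrow> complex \<Rightarrow> complex \<Rightarrow> complex \<Rightarrow> complex"
  assumes h1: "\<And>x y z. norm x < 3 \<Longrightarrow> norm y < 3 \<Longrightarrow> norm z < 3 \<Longrightarrow> (\<lambda>t. K t x y z) holomorphic_on ball 0 3"
    and h2: "\<And>t y z. norm t < 3 \<Longrightarrow> norm y < 3 \<Longrightarrow> norm z < 3 \<Longrightarrow> (\<lambda>x. K t x y z) holomorphic_on ball 0 3"
    and h3: "\<And>t x z. norm t < 3 \<Longrightarrow> norm x < 3 \<Longrightarrow> norm z < 3 \<Longrightarrow> (\<lambda>y. K t x y z) holomorphic_on ball 0 3"
    and h4: "\<And>t x y. norm t < 3 \<Longrightarrow> norm x < 3 \<Longrightarrow> norm y < 3 \<Longrightarrow> (\<lambda>z. K t x y z) holomorphic_on ball 0 3"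
    and M: "\<And>t x y z. norm t < 3 \<Longrightarrow> norm x < 3 \<Longrightarrow> norm y < 3 \<Longrightarrow> norm z < 3 \<Longrightarrow> norm (K t x y z) \<le> M"
  shows "small_series K (M * majorant_const)"
proof -
  have bd: "norm (taylor_coeff f n) \<le> B / 2 ^ n"
    if "f holomorphic_on ball 0 3" "\<And>z. norm z < 3 \<Longrightarrow> norm (f z) \<le> B" for f n B
    by (rule taylor_coeff_bound[OF that]) auto
  \<comment> \<open>The expansion takes one variable at a time, in the order t, x, y, z. At each
    stage the coefficient is shown to be bounded and holomorphic in every remaining variable, as the
    next stage requires.\<close>
  note par = taylor_coeff_param_holomorphic[where U = "ball 0 3" and r = 3]
  define A where "A p x y z = taylor_coeff (\<lambda>t. K t x y z) p" for p x y z
  have A: "norm (A p x y z) \<le> M / 2 ^ p" if "norm x < 3" "norm y < 3" "norm z < 3" for p x y z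
    unfolding A_def by (rule bd[OF h1 M]) (use that in auto)
  have A2: "(\<lambda>x. A p x y z) holomorphic_on ball 0 3" if "norm y < 3" "norm z < 3" for p y z
    unfolding A_def by (rule par) (use that h1 h2 M in auto)
  have A3: "(\<lambda>y. A p x y z) holomorphic_on ball 0 3" if "norm x < 3" "norm z < 3" for p x z
    unfolding A_def by (rule par) (use that h1 h3 M in auto)
  have A4: "(\<lambda>z. A p x y z) holomorphic_on ball 0 3" if "norm x < 3" "norm y < 3" for p x y
    unfolding A_def by (rule par) (use that h1 h4 M in auto)
  define B where "B p q y z = taylor_coeff (\<lambda>x. A p x y z) q" for p q y z
  have B: "norm (B p q y z) \<le> M / 2 ^ p / 2 ^ q" if "norm y < 3" "norm z < 3" for p q y z
    unfolding B_def by (rule bd[OF A2 A]) (use that in auto)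
  have B3: "(\<lambda>y. B p q y z) holomorphic_on ball 0 3" if "norm z < 3" for p q z
    unfolding B_def by (rule par) (use that A2 A3 A in auto)
  have B4: "(\<lambda>z. B p q y z) holomorphic_on ball 0 3" if "norm y < 3" for p q y
    unfolding B_def by (rule par) (use that A2 A4 A in auto)
  define C where "C p q i z = taylor_coeff (\<lambda>y. B p q y z) i" for p q i z
  have C: "norm (C p q i z) \<le> M / 2 ^ p / 2 ^ q / 2 ^ i" if "norm z < 3" for p q i z
    unfolding C_def by (rule bd[OF B3 B]) (use that in auto)
  have C4: "(\<lambda>z. C p q i z) holomorphic_on ball 0 3" for p q i
    unfolding C_def by (rule par) (use B3 B4 B in auto)
  define k where "k p q i j = taylor_coeff (\<lambda>z. C p q i z) j" for p q i j
  have k: "norm (k p q i j) \<le> M * (1 / 2) ^ (p + q + i + j)" for p q i j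
  proof -
    have "norm (k p q i j) \<le> M / 2 ^ p / 2 ^ q / 2 ^ i / 2 ^ j"
      unfolding k_def by (rule bd[OF C4 C])
    then show ?thesis by (simp add: power_add power_divide)
  qed
  define maj where "maj = (\<lambda>(p, q, i, j). (1 / 2 :: real) ^ (p + q + i + j) * (1 + real i + real j))"
  have maj: "(maj has_sum majorant_const) UNIV"
    unfolding maj_def majorant_const_def by (rule has_sum_infsum[OF summable_majorant])
  have Mmaj: "((\<lambda>m. M * maj m) has_sum M * majorant_const) UNIV"
    by (rule has_sum_cmult_right[OF maj])
  have kmaj: "(case m of (p, q, i, j) \<Rightarrow> norm (k p q i j) * (1 + real i + real j)) \<le> M * maj m" for m
  proof -
    obtain p q i j where m: "m = (p, q, i, j)" by (cases m) auto
    show ?thesis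
      using mult_right_mono[OF k[of p q i j], of "1 + real i + real j"] by (simp add: m maj_def mult.assoc)
  qed
  have "(\<lambda>(p, q, i, j). norm (k p q i j) * (1 + real i + real j)) summable_on UNIV"
    by (rule summable_on_comparison_test[OF has_sum_imp_summable[OF Mmaj] kmaj]) auto
  then obtain S where S: "((\<lambda>(p, q, i, j). norm (k p q i j) * (1 + real i + real j)) has_sum S) UNIV"
    by (auto simp: summable_on_def)
  have SM: "S \<le> M * majorant_const"
    by (rule has_sum_mono[OF S Mmaj kmaj])
  have "((\<lambda>(p, q, i, j). k p q i j * t ^ p * x ^ q * (y ^ i * z ^ j)) has_sum K t x y z) UNIV"
    if le: "norm t \<le> 1" "norm x \<le> 1" "norm y \<le> 1" "norm z \<le> 1" for t x y z
  proof -
    have le3: "norm t < 3" "norm x < 3" "norm y < 3" "norm z < 3" using le by auto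
    define m where "m = (\<lambda>(p, q, i, j). k p q i j * t ^ p * x ^ q * (y ^ i * z ^ j))"
    \<comment> \<open>Summability of the whole family comes first: with it the iterated sums
      \<open>s1\<close> to \<open>s4\<close> can be merged into a single sum over
      quadruples.\<close>
    have ms: "m summable_on X" for X
    proof (rule summable_on_subset_banach[of _ UNIV])
      show "m summable_on UNIV"
      proof (rule abs_summable_summable, rule Infinite_Sum.abs_summable_on_comparison_test'[OF has_sum_imp_summable[OF S]])
        fix n :: "nat \<times> nat \<times> nat \<times> nat"
        obtain p q i j where n: "n = (p, q, i, j)" by (cases n) auto
        have "norm (m n) = norm (k p q i j * t ^ p * x ^ q * y ^ i * z ^ j)"
          by (simp add: m_def n mult.assoc)
        also have "\<dots> \<le> norm (k p q i j * t ^ p * x ^ q)"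
          by (rule norm_monom_le) (use le in auto)
        also have "\<dots> \<le> norm (k p q i j)"
          by (rule norm_monom_le) (use le in auto)
        also have "\<dots> \<le> norm (k p q i j) * (1 + real i + real j)"
          by (simp add: algebra_simps)
        finally show "norm (m n) \<le> (case n of (p, q, i, j) \<Rightarrow> norm (k p q i j) * (1 + real i + real j))"
          by (simp add: n)
      qed
    qed simp
    have ms2: "(\<lambda>n. m (p, n)) summable_on UNIV" for p
      using summable_on_SigmaD1[of "\<lambda>p n. m (p, n)" UNIV "\<lambda>_. UNIV" p] ms[of "UNIV \<times> UNIV"] by simp
    have ms3: "(\<lambda>n. m (p, q, n)) summable_on UNIV" for p q
      using summable_on_SigmaD1[of "\<lambda>q n. m (p, q, n)" UNIV "\<lambda>_. UNIV" q] ms2[of p]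
      by (simp add: case_prod_unfold)
    have s1: "((\<lambda>j. m (p, q, i, j)) has_sum C p q i z * t ^ p * x ^ q * y ^ i) UNIV" for p q i
      using has_sum_cmult_right[OF taylor_coeff_has_sum[OF C4 C le3(4)], of "t ^ p * x ^ q * y ^ i" p q i]
      unfolding m_def k_def by (simp add: mult_ac)
    have s2: "((\<lambda>i. C p q i z * t ^ p * x ^ q * y ^ i) has_sum B p q y z * t ^ p * x ^ q) UNIV" for p q
      using has_sum_cmult_right[OF taylor_coeff_has_sum[OF B3[OF le3(4)] B[OF _ le3(4)] le3(3)], of "t ^ p * x ^ q" p q]
      unfolding C_def by (simp add: mult_ac)
    have s3: "((\<lambda>q. B p q y z * t ^ p * x ^ q) has_sum A p x y z * t ^ p) UNIV" for p
      using has_sum_cmult_right[OF taylor_coeff_has_sum[OF A2[OF le3(3,4)] A[OF _ le3(3,4)] le3(2)], of "t ^ p" p]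
      unfolding B_def by (simp add: mult_ac)
    have s4: "((\<lambda>p. A p x y z * t ^ p) has_sum K t x y z) UNIV"
      using taylor_coeff_has_sum[OF h1[OF le3(2-4)] M[OF _ le3(2-4)] le3(1)] unfolding A_def .
    have u2: "((\<lambda>n. m (p, q, n)) has_sum B p q y z * t ^ p * x ^ q) UNIV" for p q
      using has_sum_SigmaI[where A = UNIV and f = "\<lambda>n. m (p, q, n)" and g = "\<lambda>i. C p q i z * t ^ p * x ^ q * y ^ i" and B = "\<lambda>_. UNIV", OF s1 s2] ms3
      by simp
    have u3: "((\<lambda>n. m (p, n)) has_sum A p x y z * t ^ p) UNIV" for p
      using has_sum_SigmaI[where A = UNIV and f = "\<lambda>n. m (p, n)" and g = "\<lambda>q. B p q y z * t ^ p * x ^ q" and B = "\<lambda>_. UNIV", OF u2 s3] ms2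
      by simp
    have "(m has_sum K t x y z) UNIV"
      using has_sum_SigmaI[where A = UNIV and f = m and g = "\<lambda>p. A p x y z * t ^ p" and B = "\<lambda>_. UNIV", OF u3 s4] ms
      by simp
    then show ?thesis unfolding m_def .
  qed
  then show ?thesis
    unfolding small_series_def using S SM by blast
qed

section \<open>Uniqueness\<close>

lemma DERIV_pos_at_right_less:
  fixes f :: "real \<Rightarrow> real"
  assumes "(f has_real_derivative D) (at 0)" "0 < D"
  shows "\<forall>\<^sub>F s in at_right 0. f 0 < f s"
  using DERIV_pos_inc_right[OF assms] by (auto simp: eventually_at_right_field)

text \<open>A maximum principle on [\<tau>, t0] times a closed disc, for real t only. The bound
  \<epsilon> \<le> \<delta>/4 is used twice: for the growth of |w|^2 and, together with r \<ge> 1/2,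
  for the direction of the characteristics on the circle |x| = r.\<close>

lemma solution_unique:
  fixes y1 y2 :: "complex \<times> complex \<Rightarrow> complex"
    and a1 a2 b1 b2 :: "real \<Rightarrow> complex \<Rightarrow> complex" and lam c :: complex
  assumes K: "small_series K \<epsilon>"
    and \<delta>: "\<delta> > 0" "Re lam \<le> - \<delta>" "Re c \<le> - \<delta>" and \<epsilon>: "\<epsilon> \<le> \<delta> / 4"
    and r: "1 / 2 \<le> r" "r < 1"
    and D1: "\<And>t x. 0 < t \<Longrightarrow> t < 1 \<Longrightarrow> norm x < 1 \<Longrightarrow>
      (y1 has_derivative (\<lambda>(h, k). a1 t x * h + b1 t x * k)) (at (of_real t, x))"
    and D2: "\<And>t x. 0 < t \<Longrightarrow> t < 1 \<Longrightarrow> norm x < 1 \<Longrightarrow>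
      (y2 has_derivative (\<lambda>(h, k). a2 t x * h + b2 t x * k)) (at (of_real t, x))"
    and E1: "\<And>t x. 0 < t \<Longrightarrow> t < 1 \<Longrightarrow> norm x < 1 \<Longrightarrow>
      of_real t * a1 t x = lam * y1 (of_real t, x) + c * x * b1 t x + K (of_real t) x (y1 (of_real t, x)) (b1 t x)"
    and E2: "\<And>t x. 0 < t \<Longrightarrow> t < 1 \<Longrightarrow> norm x < 1 \<Longrightarrow>
      of_real t * a2 t x = lam * y2 (of_real t, x) + c * x * b2 t x + K (of_real t) x (y2 (of_real t, x)) (b2 t x)"
    and B1: "\<And>t x. 0 < t \<Longrightarrow> t < 1 \<Longrightarrow> norm x < 1 \<Longrightarrow> norm (y1 (of_real t, x)) \<le> 1 \<and> norm (b1 t x) \<le> 1"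
    and B2: "\<And>t x. 0 < t \<Longrightarrow> t < 1 \<Longrightarrow> norm x < 1 \<Longrightarrow> norm (y2 (of_real t, x)) \<le> 1 \<and> norm (b2 t x) \<le> 1"
    and t0: "0 < t0" "t0 < 1" and x0: "norm x0 \<le> r"
  shows "y1 (of_real t0, x0) = y2 (of_real t0, x0)"
proof -
  define w where "w t x = y1 (of_real t, x) - y2 (of_real t, x)" for t x
  define a b where "a t x = a1 t x - a2 t x" and "b t x = b1 t x - b2 t x" for t x
  \<comment> \<open>The weight forces decay of a bounded \<open>w\<close> as t tends to 0. It is
    weak enough to lose against |w|^2, whose relative growth rate backwards along the
    characteristics is at least 3\<delta>/2.\<close>
  define \<Phi> where "\<Phi> t x = t powr \<delta> * (norm (w t x))\<^sup>2" for t x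
  have w_le: "norm (w t x) \<le> 2" if "0 < t" "t < 1" "norm x < 1" for t x
    using B1[OF that] B2[OF that] norm_triangle_ineq4[of "y1 (of_real t, x)" "y2 (of_real t, x)"]
    by (simp add: w_def)
  text \<open>At every point the equation for the difference \<open>w\<close> is a linear transport equation, whose
    coefficients are close to \<open>lam\<close> and \<open>c * x\<close>.\<close>
  have lin: "\<exists>A B. of_real t * a t x = A * w t x + B * b t x \<and> norm (A - lam) \<le> \<epsilon> \<and> norm (B - c * x) \<le> \<epsilon>"
    if tx: "0 < t" "t < 1" "norm x < 1" for t x
  proof -
    define Q where "Q = K (of_real t) x (y1 (of_real t, x)) (b1 t x) - K (of_real t) x (y2 (of_real t, x)) (b2 t x)"
    have eq: "of_real t * a t x = lam * w t x + c * x * b t x + Q"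
      using E1[OF tx] E2[OF tx] by (simp add: a_def b_def w_def Q_def algebra_simps)
    have e0: "0 \<le> \<epsilon>"
      using wiener_nonneg[OF small_series_wiener[OF K, of "\<lambda>_ _. 0" "\<lambda>_ _. 0"]]
        wiener_mono[OF wiener_const[of 0], of 1] by simp
    have Q: "norm Q \<le> \<epsilon> * (norm (w t x) + norm (b t x))"
    proof -
      have "norm Q \<le> \<epsilon> * max (norm (w t x)) (norm (b t x))"
        unfolding Q_def w_def b_def
        by (rule small_series_lipschitz[OF K]) (use tx B1[OF tx] B2[OF tx] in auto)
      also have "\<dots> \<le> \<epsilon> * (norm (w t x) + norm (b t x))"
        using e0 by (intro mult_left_mono) auto
      finally show ?thesis .
    qed
    \<comment> \<open>\<open>Q\<close> is shared between the two unknowns in proportion to |w| and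
      |b|. Since |z| = cnj (sgn z) * z, the product of Q / m with |w| + |b| is linear in w and b,
      with coefficients of modulus at most \<epsilon>. If m = 0, the bound on \<open>Q\<close> gives
      Q = 0.\<close>
    define m where "m = norm (w t x) + norm (b t x)"
    show ?thesis
    proof (cases "m = 0")
      case True
      then have "w t x = 0" "b t x = 0"
        unfolding m_def by (smt (verit) norm_ge_zero norm_le_zero_iff)+
      then show ?thesis
        using eq Q e0 by (intro exI[of _ lam] exI[of _ "c * x"]) auto
    next
      case False
      then have m: "m > 0" by (smt (verit) m_def norm_ge_zero)
      have cs: "cnj (sgn z) * z = of_real (norm z)" for z
        using complex_norm_square[of z]
        by (cases "z = 0") (simp_all add: sgn_div_norm scaleR_conv_of_real field_simps power2_eq_square)
      have sg: "norm (Q / of_real m * cnj (sgn z)) \<le> \<epsilon>" for z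
      proof -
        have "norm (cnj (sgn z)) \<le> 1" by (simp add: norm_sgn)
        moreover have "norm (Q / of_real m) \<le> \<epsilon>"
          using Q m unfolding m_def[symmetric] by (simp add: norm_divide pos_divide_le_eq)
        ultimately show ?thesis
          unfolding norm_mult using mult_mono[of "norm (Q / of_real m)" \<epsilon> "norm (cnj (sgn z))" 1] e0 by simp
      qed
      have "Q / of_real m * cnj (sgn (w t x)) * w t x + Q / of_real m * cnj (sgn (b t x)) * b t x =
          Q / of_real m * of_real m"
        unfolding mult.assoc cs m_def by (simp add: distrib_left)
      then have "of_real t * a t x = (lam + Q / of_real m * cnj (sgn (w t x))) * w t x +
          (c * x + Q / of_real m * cnj (sgn (b t x))) * b t x"
        using m unfolding eq by (simp add: algebra_simps)
      then show ?thesis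
        using sg[of "w t x"] sg[of "b t x"] by (intro exI conjI) auto
    qed
  qed
  \<comment> \<open>The maximum over the compact set is compared with the values at t = \<tau>,
    where |w| \<le> 2.\<close>
  have le: "\<Phi> t0 x0 \<le> 4 * \<tau> powr \<delta>" if \<tau>: "0 < \<tau>" "\<tau> < t0" for \<tau>
  proof -
    have cont: "continuous_on ({\<tau>..t0} \<times> cball 0 r) (\<lambda>p. \<Phi> (fst p) (snd p))"
    proof -
      have "continuous_on ({\<tau>..t0} \<times> cball 0 r) (\<lambda>p. y (complex_of_real (fst p), snd p))"
        if D: "\<And>t x. 0 < t \<Longrightarrow> t < 1 \<Longrightarrow> norm x < 1 \<Longrightarrow>
          (y has_derivative (\<lambda>(h, k). a t x * h + b t x * k)) (at (of_real t, x))"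
        for y :: "complex \<times> complex \<Rightarrow> complex" and a b
      proof -
        have "continuous_on ((\<lambda>p. (complex_of_real (fst p), snd p)) ` ({\<tau>..t0} \<times> cball 0 r)) y"
        proof (intro continuous_at_imp_continuous_on ballI)
          fix p :: "complex \<times> complex"
          assume "p \<in> (\<lambda>p. (complex_of_real (fst p), snd p)) ` ({\<tau>..t0} \<times> cball 0 r)"
          then obtain t x where "p = (of_real t, x)" "0 < t" "t < 1" "norm x < 1"
            using \<tau> t0 r by auto
          then show "isCont y p"
            using has_derivative_continuous[OF D[of t x]] by simp
        qed
        then show ?thesis
          by (rule continuous_on_compose2) (auto intro!: continuous_intros)
      qed
      then show ?thesis
        unfolding \<Phi>_def w_def using D1 D2 \<tau>
        by (intro continuous_intros) auto
    qed
    obtain p where p: "p \<in> {\<tau>..t0} \<times> cball 0 r"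
        and max: "\<And>q. q \<in> {\<tau>..t0} \<times> cball 0 r \<Longrightarrow> \<Phi> (fst q) (snd q) \<le> \<Phi> (fst p) (snd p)"
      using continuous_attains_sup[OF _ _ cont] compact_Times[of "{\<tau>..t0}" "cball (0::complex) r"] \<tau> r
      by (auto simp: compact_cball)
    obtain ts xs where ps: "p = (ts, xs)" by fastforce
    have ts: "\<tau> \<le> ts" "ts \<le> t0" "0 < ts" "ts < 1" and xs: "norm xs \<le> r" "norm xs < 1"
      using p ps \<tau> t0 r by auto
    have "\<Phi> ts xs \<le> 4 * \<tau> powr \<delta>"
    \<comment> \<open>A maximum at the initial time or at a zero of \<open>w\<close> gives the bound
      directly; any other one is refuted by a nearby point of the set with a larger value.\<close>
    proof (cases "w ts xs = 0 \<or> ts = \<tau>")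
      case True
      moreover have "\<Phi> \<tau> xs \<le> 4 * \<tau> powr \<delta>"
      proof -
        have "(norm (w \<tau> xs))\<^sup>2 \<le> 2\<^sup>2"
          using w_le[of \<tau> xs] \<tau> t0 xs by (intro power_mono) auto
        from mult_left_mono[OF this, of "\<tau> powr \<delta>"] show ?thesis
          by (simp add: \<Phi>_def mult.commute)
      qed
      ultimately show ?thesis
        by (auto simp: \<Phi>_def)
    next
      case False
      then have w0: "w ts xs \<noteq> 0" and tts: "\<tau> < ts" using ts by auto
      obtain A B where AB: "of_real ts * a ts xs = A * w ts xs + B * b ts xs"
          and A: "norm (A - lam) \<le> \<epsilon>" and B: "norm (B - c * xs) \<le> \<epsilon>"
        using lin[OF ts(3,4) xs(2)] by blast
      text \<open>Moving backwards in \<open>t\<close> along the characteristic stays in the domain and increases \<open>\<Phi>\<close>.\<close>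
      define h where "h s = \<Phi> (ts * (1 - s)) (xs + of_real s * B)" for s
      \<comment> \<open>A straight segment with frozen direction \<open>B\<close> suffices, because
        only the derivative at s = 0 matters; there it is -t w_t + B w_x = -A w.\<close>
      have w_der: "((\<lambda>s. w (ts * (1 - s)) (xs + of_real s * B)) has_vector_derivative
          (- (A * w ts xs))) (at 0)"
      proof -
        have curve: "((\<lambda>s. (complex_of_real (ts * (1 - s)), xs + of_real s * B)) has_derivative
            (\<lambda>s. (- of_real ts * of_real s, of_real s * B))) (at (0::real))"
        proof (rule has_derivative_Pair)
          have "((\<lambda>s. ts * (1 - s)) has_derivative (\<lambda>s. - ts * s)) (at 0)"
            by (auto intro!: derivative_eq_intros)
          from has_derivative_of_real[OF this]
          show "((\<lambda>s. complex_of_real (ts * (1 - s))) has_derivative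
              (\<lambda>s. - of_real ts * of_real s)) (at 0)"
            by simp
          show "((\<lambda>s. xs + of_real s * B) has_derivative (\<lambda>s. of_real s * B)) (at (0::real))"
            by (auto intro!: derivative_eq_intros)
        qed
        have chain: "((\<lambda>s. y (of_real (ts * (1 - s)), xs + of_real s * B)) has_derivative
            (\<lambda>s. a ts xs * (- of_real ts * of_real s) + b ts xs * (of_real s * B))) (at (0::real))"
          if D: "(y has_derivative (\<lambda>(h, k). a ts xs * h + b ts xs * k)) (at (of_real ts, xs))"
          for y :: "complex \<times> complex \<Rightarrow> complex" and a b :: "real \<Rightarrow> complex \<Rightarrow> complex"
        proof -
          have "(y has_derivative (\<lambda>(h, k). a ts xs * h + b ts xs * k))
              (at ((\<lambda>s. (complex_of_real (ts * (1 - s)), xs + of_real s * B)) (0::real)))"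
            using D by simp
          from diff_chain_at[OF curve this] show ?thesis
            by (simp add: o_def)
        qed
        have "((\<lambda>s. w (ts * (1 - s)) (xs + of_real s * B)) has_derivative
            (\<lambda>s. (a1 ts xs * (- of_real ts * of_real s) + b1 ts xs * (of_real s * B)) -
              (a2 ts xs * (- of_real ts * of_real s) + b2 ts xs * (of_real s * B)))) (at (0::real))"
          unfolding w_def
          by (rule has_derivative_diff[OF chain[where y = y1 and a = a1 and b = b1, OF D1]
              chain[where y = y2 and a = a2 and b = b2, OF D2]]) (use ts xs in auto)
        moreover have "(\<lambda>s. (a1 ts xs * (- of_real ts * of_real s) + b1 ts xs * (of_real s * B)) -
              (a2 ts xs * (- of_real ts * of_real s) + b2 ts xs * (of_real s * B))) =
              (\<lambda>s. s *\<^sub>R (- (of_real ts * a ts xs) + B * b ts xs))"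
          by (simp add: fun_eq_iff scaleR_conv_of_real a_def b_def algebra_simps)
        ultimately show ?thesis
          unfolding has_vector_derivative_def AB by simp
      qed
      define W where "W s = w (ts * (1 - s)) (xs + of_real s * B)" for s
      have W0: "W 0 = w ts xs" by (simp add: W_def)
      have "((\<lambda>s. (ts * (1 - s)) powr \<delta> * (W s \<bullet> W s)) has_real_derivative
          (- \<delta> * ts powr \<delta>) * (norm (w ts xs))\<^sup>2 +
          ts powr \<delta> * (2 * (w ts xs \<bullet> (- (A * w ts xs))))) (at 0)"
      proof -
        have d1: "((\<lambda>s. W s \<bullet> W s) has_real_derivative 2 * (w ts xs \<bullet> (- (A * w ts xs)))) (at 0)"
        proof -
          have "(W has_derivative (\<lambda>s. s *\<^sub>R (- (A * w ts xs)))) (at 0)"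
            using w_der unfolding has_vector_derivative_def W_def .
          then have "((\<lambda>s. W s \<bullet> W s) has_derivative
             (\<lambda>s. W 0 \<bullet> (s *\<^sub>R (- (A * w ts xs))) + (s *\<^sub>R (- (A * w ts xs))) \<bullet> W 0)) (at 0)"
            by (rule has_derivative_inner) fact
          then show ?thesis
            unfolding has_field_derivative_def W0
            by (rule has_derivative_eq_rhs) (auto simp: fun_eq_iff inner_commute)
        qed
        have d2: "((\<lambda>s. (ts * (1 - s)) powr \<delta>) has_real_derivative (- \<delta> * ts powr \<delta>)) (at 0)"
          using ts by (auto intro!: derivative_eq_intros simp: powr_diff)
        show ?thesis
          by (rule DERIV_cong[OF DERIV_mult[OF d2 d1]]) (simp add: W0 dot_square_norm)
      qed
      moreover have "(\<lambda>s. (ts * (1 - s)) powr \<delta> * (W s \<bullet> W s)) = h"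
        by (simp add: fun_eq_iff h_def \<Phi>_def W_def dot_square_norm)
      moreover have "w ts xs \<bullet> (- (A * w ts xs)) = - Re A * (norm (w ts xs))\<^sup>2"
        unfolding inner_complex_def cmod_power2 by (simp add: algebra_simps power2_eq_square)
      ultimately have "(h has_real_derivative ts powr \<delta> * (norm (w ts xs))\<^sup>2 * (- \<delta> - 2 * Re A)) (at 0)"
        by (simp add: algebra_simps)
      \<comment> \<open>Re A \<le> -\<delta> + \<delta>/4 makes the last factor at least
        \<delta>/2.\<close>
      moreover have "0 < ts powr \<delta> * (norm (w ts xs))\<^sup>2 * (- \<delta> - 2 * Re A)"
      proof -
        have "Re A - Re lam \<le> \<epsilon>"
          using abs_Re_le_cmod[of "A - lam"] A by simp
        then show ?thesis
          using \<delta> \<epsilon> w0 ts by (intro mult_pos_pos) auto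
      qed
      ultimately have inc: "\<forall>\<^sub>F s in at_right 0. h 0 < h s"
        by (rule DERIV_pos_at_right_less)
      \<comment> \<open>Interior points stay inside by continuity. On |x| = r the velocity points
        inwards: in its inner product with x the part c x contributes at most -\<delta> r^2 and the
        error at most r \<delta>/4, and r \<ge> 1/2 > 1/4.\<close>
      have inside: "\<forall>\<^sub>F s in at_right 0. xs + of_real s * B \<in> cball 0 r"
      proof (cases "norm xs = r")
        case True
        define g where "g s = - ((xs + of_real s * B) \<bullet> (xs + of_real s * B))" for s :: real
        have "(g has_real_derivative - (2 * (xs \<bullet> B))) (at 0)"
          unfolding g_def has_field_derivative_def
          by (rule derivative_eq_intros refl)+ (auto simp: fun_eq_iff inner_commute algebra_simps inner_complex_def)
        moreover have "xs \<bullet> B < 0"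
        proof -
          have "xs \<bullet> (c * xs) = Re c * r\<^sup>2"
            unfolding True[symmetric] inner_complex_def cmod_power2
            by (simp add: algebra_simps power2_eq_square)
          also have "\<dots> \<le> - \<delta> * r\<^sup>2"
            using \<delta> by (intro mult_right_mono) auto
          finally have 1: "xs \<bullet> (c * xs) \<le> - \<delta> * r\<^sup>2" .
          have "xs \<bullet> (B - c * xs) \<le> norm xs * norm (B - c * xs)"
            by (rule norm_cauchy_schwarz)
          also have "\<dots> \<le> r * (\<delta> / 4)"
            using True B \<epsilon> r by (intro mult_mono) auto
          finally have "xs \<bullet> B \<le> - \<delta> * r\<^sup>2 + r * (\<delta> / 4)"
            using 1 by (simp add: inner_diff_right)
          also have "\<dots> = \<delta> * r * (1 / 4 - r)"
            by (simp add: algebra_simps power2_eq_square)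
          also have "\<dots> < 0"
            using \<delta> r by (intro mult_pos_neg) auto
          finally show ?thesis .
        qed
        ultimately have "\<forall>\<^sub>F s in at_right 0. g 0 < g s"
          by (intro DERIV_pos_at_right_less) auto
        then show ?thesis
        proof eventually_elim
          case (elim s)
          then have "(norm (xs + of_real s * B))\<^sup>2 \<le> r\<^sup>2"
            using True by (simp add: g_def dot_square_norm)
          then show ?case
            using r by (simp add: power2_le_iff_abs_le abs_le_square_iff)
        qed
      next
        case False
        then have "xs \<in> ball 0 r" using xs by simp
        moreover have "((\<lambda>s. xs + of_real s * B) \<longlongrightarrow> xs + of_real 0 * B) (at_right (0::real))"
          by (intro tendsto_intros)
        ultimately have "\<forall>\<^sub>F s in at_right (0::real). xs + of_real s * B \<in> ball 0 r"
          by (intro topological_tendstoD) auto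
        then show ?thesis by eventually_elim auto
      qed
      have later: "\<forall>\<^sub>F s in at_right 0. \<tau> < ts * (1 - s)"
      proof (rule order_tendstoD)
        show "((\<lambda>s. ts * (1 - s)) \<longlongrightarrow> ts * (1 - 0)) (at_right 0)"
          by (intro tendsto_intros)
      qed (use tts in simp)
      have "\<forall>\<^sub>F s in at_right (0::real). False"
        using inc inside later eventually_at_right_less[of 0]
      proof eventually_elim
        case (elim s)
        have "ts * (1 - s) \<le> ts" using elim ts by (simp add: algebra_simps)
        then have "ts * (1 - s) \<le> t0" using ts by linarith
        then have "h s \<le> \<Phi> ts xs"
          using max[of "(ts * (1 - s), xs + of_real s * B)"] elim ts by (simp add: h_def ps)
        moreover have "h 0 = \<Phi> ts xs" by (simp add: h_def)
        ultimately show False using elim by simp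
      qed
      then show ?thesis by simp
    qed
    then show ?thesis
      using max[of "(t0, x0)"] \<tau> x0 ps by simp
  qed
  have "((\<lambda>\<tau>. 4 * \<tau> powr \<delta>) \<longlongrightarrow> 4 * 0) (at_right 0)"
  proof (intro tendsto_intros)
    have "((\<lambda>\<tau>. \<tau> powr \<delta>) \<longlongrightarrow> 0 powr \<delta>) (at_right 0)"
      by (rule tendsto_powr') (use \<delta> in \<open>auto simp: eventually_at_right_less intro: eventually_mono[OF eventually_at_right_less]\<close>)
    then show "((\<lambda>\<tau>. \<tau> powr \<delta>) \<longlongrightarrow> 0) (at_right 0)" by simp
  qed
  then have "\<Phi> t0 x0 \<le> 4 * 0"
    by (rule tendsto_lowerbound)
      (use le t0 in \<open>auto simp: eventually_at_right_field intro!: exI[of _ t0]\<close>)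
  then have "t0 powr \<delta> * (norm (w t0 x0))\<^sup>2 = 0"
    by (smt (verit) \<Phi>_def mult_nonneg_nonneg powr_ge_zero zero_le_power2)
  then show ?thesis
    using t0 by (simp add: w_def)
qed

section \<open>Existence\<close>

text \<open>Builds the joint complex-linear derivative that \<open>holomorphic2_on\<close> demands
  out of what the iteration delivers: a t-derivative at the point and an x-derivative
  \<open>V\<close> that is continuous as a uniform limit.\<close>

lemma has_derivative_complex_partials:
  fixes f :: "complex \<Rightarrow> complex \<Rightarrow> complex"
  assumes S: "open S" "open T" "convex T" "t \<in> S" "x \<in> T"
    and fst: "((\<lambda>t. f t x) has_field_derivative D) (at t)"
    and snd: "\<And>t x. t \<in> S \<Longrightarrow> x \<in> T \<Longrightarrow> (f t has_field_derivative V t x) (at x)"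
    and cont: "continuous_on (S \<times> T) (\<lambda>(t, x). V t x)"
  shows "((\<lambda>(t, x). f t x) has_derivative (\<lambda>(h, k). D * h + V t x * k)) (at (t, x))"
proof -
  have "((\<lambda>(t, x). f t x) has_derivative (\<lambda>(h, k). D * h + blinfun_apply (blinfun_mult_right (V t x)) k))
      (at (t, x) within S \<times> T)"
  proof (rule has_derivative_partialsI)
    show "((\<lambda>t. f t x) has_derivative (*) D) (at t within S)"
      using fst by (simp add: has_field_derivative_def has_derivative_at_withinI)
    show "(f t has_derivative blinfun_apply (blinfun_mult_right (V t x))) (at x within T)"
      if "t \<in> S" "x \<in> T" for t x
      using snd[OF that] by (simp add: has_field_derivative_def has_derivative_at_withinI)
    have "continuous_on (S \<times> T) (\<lambda>p. blinfun_mult_right ((\<lambda>(t, x). V t x) p))"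
      by (intro continuous_on_compose2[OF linear_continuous_on[OF bounded_linear_blinfun_mult_right] cont]) auto
    then have "continuous_on (S \<times> T) (\<lambda>(t, x). blinfun_mult_right (V t x))"
      by (simp add: case_prod_unfold)
    then show "continuous (at (t, x) within S \<times> T) (\<lambda>(t, x). blinfun_mult_right (V t x))"
      using S by (auto simp: continuous_on_eq_continuous_within)
  qed (use S in auto)
  then show ?thesis
    using at_within_open[of "(t, x)" "S \<times> T"] S by (simp add: open_Times)
qed

lemma geometric_uniform_limit:
  fixes g :: "nat \<Rightarrow> 'a \<Rightarrow> 'b::banach"
  assumes "\<And>n p. p \<in> S \<Longrightarrow> norm (g (Suc n) p - g n p) \<le> (1 / 2) ^ n"
  shows "\<exists>l. uniform_limit S g l sequentially"
proof -
  have tele: "(\<Sum>k<n. g (Suc k) p - g k p) = g n p - g 0 p" for n p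
    using sum_lessThan_telescope[of "\<lambda>k. g k p" n] by simp
  have "uniform_limit S (\<lambda>n p. \<Sum>k<n. g (Suc k) p - g k p) (\<lambda>p. \<Sum>k. g (Suc k) p - g k p) sequentially"
    by (rule Weierstrass_m_test[where M = "\<lambda>n. (1 / 2) ^ n"]) (use assms in auto)
  then have "uniform_limit S (\<lambda>n p. g n p - g 0 p) (\<lambda>p. \<Sum>k. g (Suc k) p - g k p) sequentially"
    unfolding tele .
  from uniform_limit_add[OF this uniform_limit_const[where c = "g 0"]]
  show ?thesis by auto
qed

text \<open>Each step adds the correction that \<open>wiener_solve\<close> returns for the current
  defect. The old defect then cancels, and the new one is the change of \<open>K\<close>, at most
  \<epsilon> times the correction. As \<epsilon>/\<delta> \<le> 1/4, the bounds on defect and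
  correction can be halved at every step.\<close>

lemma solution_exists:
  fixes lam c :: complex
  assumes K: "small_series K \<epsilon>"
    and \<delta>: "\<delta> > 0" "Re lam \<le> - \<delta>" "Re c \<le> - \<delta>" and \<epsilon>: "\<epsilon> \<le> \<delta> / 4"
  obtains Y D V where
    "\<And>t x. norm t < 1 \<Longrightarrow> norm x < 1 \<Longrightarrow>
      ((\<lambda>(t, x). Y t x) has_derivative (\<lambda>(h, k). D t x * h + V t x * k)) (at (t, x))"
    "\<And>t x. norm t < 1 \<Longrightarrow> norm x < 1 \<Longrightarrow> t * D t x = lam * Y t x + c * x * V t x + K t x (Y t x) (V t x)"
    "\<And>t x. norm t < 1 \<Longrightarrow> norm x < 1 \<Longrightarrow> norm (Y t x) \<le> 1 \<and> norm (V t x) \<le> 1"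
proof -
  text \<open>A state of the iteration is an approximate solution \<open>u\<close>, its derivative \<open>v\<close> in \<open>x\<close> and its
    defect \<open>f\<close>.\<close>
  define P :: "nat \<Rightarrow> (complex \<Rightarrow> complex \<Rightarrow> complex) \<times> (complex \<Rightarrow> complex \<Rightarrow> complex) \<times>
      (complex \<Rightarrow> complex \<Rightarrow> complex) \<Rightarrow> bool"
    where "P n = (\<lambda>(u, v, f). wiener u ((1 - (1 / 2) ^ n) / 2) \<and> wiener v ((1 - (1 / 2) ^ n) / 2) \<and>
      wiener f (\<epsilon> * (1 / 2) ^ n) \<and>
      (\<forall>t x. norm t \<le> 1 \<longrightarrow> norm x < 1 \<longrightarrow> (u t has_field_derivative v t x) (at x)) \<and>
      (\<forall>t x. norm t < 1 \<longrightarrow> norm x < 1 \<longrightarrow> t * deriv (\<lambda>s. u s x) t =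
        lam * u t x + c * x * v t x + K t x (u t x) (v t x) - f t x))" for n
  define Q :: "nat \<Rightarrow> (complex \<Rightarrow> complex \<Rightarrow> complex) \<times> (complex \<Rightarrow> complex \<Rightarrow> complex) \<times>
      (complex \<Rightarrow> complex \<Rightarrow> complex) \<Rightarrow> (complex \<Rightarrow> complex \<Rightarrow> complex) \<times>
      (complex \<Rightarrow> complex \<Rightarrow> complex) \<times> (complex \<Rightarrow> complex \<Rightarrow> complex) \<Rightarrow> bool"
    where "Q n = (\<lambda>(u, v, f) (u', v', f'). wiener (\<lambda>t x. u' t x - u t x) ((1 / 2) ^ n / 4) \<and>
      wiener (\<lambda>t x. v' t x - v t x) ((1 / 2) ^ n / 4))" for n
  have w0: "wiener (\<lambda>_ _. 0) 0"
    using wiener_const[of 0] by simp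
  have e0: "0 \<le> \<epsilon>"
    using wiener_nonneg[OF small_series_wiener[OF K, of "\<lambda>_ _. 0" "\<lambda>_ _. 0"]] wiener_mono[OF w0, of 1]
    by simp
  have "\<exists>s. \<forall>n. P n (s n) \<and> Q n (s n) (s (Suc n))"
  proof (rule dependent_nat_choice)
    have "P 0 (\<lambda>_ _. 0, \<lambda>_ _. 0, \<lambda>t x. K t x 0 0)"
      using small_series_wiener[OF K, of "\<lambda>_ _. 0" "\<lambda>_ _. 0"] wiener_mono[OF w0, of 1] w0
      by (simp add: P_def)
    then show "\<exists>s. P 0 s" by blast
    fix s n assume "P n s"
    moreover obtain u v f where s: "s = (u, v, f)" by (cases s) auto
    ultimately have u: "wiener u ((1 - (1 / 2) ^ n) / 2)" and v: "wiener v ((1 - (1 / 2) ^ n) / 2)"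
      and f: "wiener f (\<epsilon> * (1 / 2) ^ n)"
      and uv: "\<And>t x. norm t \<le> 1 \<Longrightarrow> norm x < 1 \<Longrightarrow> (u t has_field_derivative v t x) (at x)"
      and eq: "\<And>t x. norm t < 1 \<Longrightarrow> norm x < 1 \<Longrightarrow> t * deriv (\<lambda>s. u s x) t =
        lam * u t x + c * x * v t x + K t x (u t x) (v t x) - f t x"
      by (auto simp: P_def)
    obtain e w where e: "wiener e (\<epsilon> * (1 / 2) ^ n / \<delta>)" and w: "wiener w (\<epsilon> * (1 / 2) ^ n / \<delta>)"
      and ew: "\<And>t x. norm t \<le> 1 \<Longrightarrow> norm x < 1 \<Longrightarrow> (e t has_field_derivative w t x) (at x)"
      and eeq: "\<And>t x. norm t < 1 \<Longrightarrow> norm x < 1 \<Longrightarrow>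
        t * deriv (\<lambda>s. e s x) t = lam * e t x + c * x * w t x + f t x"
      by (rule wiener_solve[OF f \<delta>]) blast
    have le: "\<epsilon> * (1 / 2) ^ n / \<delta> \<le> (1 / 2) ^ n / 4"
      using \<epsilon> \<delta> mult_right_mono[OF \<epsilon>, of "(1 / 2) ^ n"] by (simp add: field_simps)
    have e': "wiener e ((1 / 2) ^ n / 4)" and w': "wiener w ((1 / 2) ^ n / 4)"
      using e w le wiener_mono by blast+
    define u' v' where "u' t x = u t x + e t x" and "v' t x = v t x + w t x" for t x
    define f' where "f' t x = K t x (u' t x) (v' t x) - K t x (u t x) (v t x)" for t x
    \<comment> \<open>The corrections, bounded by 2^-k/4 for k < n, add up to at most (1 - 2^-n)/2.
      All iterates thus stay in the unit ball, where the series of \<open>K\<close> may be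
      substituted into.\<close>
    have half: "(1 - (1 / 2) ^ n) / 2 + (1 / 2) ^ n / 4 = (1 - (1 / 2) ^ Suc n) / (2 :: real)"
      by (simp add: field_simps)
    have u': "wiener u' ((1 - (1 / 2) ^ Suc n) / 2)" and v': "wiener v' ((1 - (1 / 2) ^ Suc n) / 2)"
      using wiener_add[OF u e'] wiener_add[OF v w'] unfolding half u'_def v'_def by simp_all
    have one: "(1 - (1 / 2) ^ n) / 2 \<le> (1 :: real)" for n
    proof -
      have "0 \<le> (1 / 2 :: real) ^ n" by simp
      then show ?thesis by (simp only: field_simps)
    qed
    have "wiener f' (\<epsilon> * ((1 / 2) ^ n / 4))"
      unfolding f'_def
    proof (rule small_series_wiener_diff[OF K])
      show "wiener u 1" "wiener v 1" "wiener u' 1" "wiener v' 1"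
        using u v u' v' one wiener_mono by blast+
      show "wiener (\<lambda>t x. u' t x - u t x) ((1 / 2) ^ n / 4)" "wiener (\<lambda>t x. v' t x - v t x) ((1 / 2) ^ n / 4)"
        using e' w' by (simp_all add: u'_def v'_def)
    qed
    then have f': "wiener f' (\<epsilon> * (1 / 2) ^ Suc n)"
      by (rule wiener_mono) (use e0 in \<open>simp add: mult_left_mono\<close>)
    have uv': "(u' t has_field_derivative v' t x) (at x)" if "norm t \<le> 1" "norm x < 1" for t x
      unfolding u'_def v'_def by (rule DERIV_add[OF uv[OF that] ew[OF that]])
    have eq': "t * deriv (\<lambda>s. u' s x) t = lam * u' t x + c * x * v' t x + K t x (u' t x) (v' t x) - f' t x"
      if tx: "norm t < 1" "norm x < 1" for t x
    proof -
      have "(\<lambda>s. g s x) field_differentiable at t" if "wiener g b" for g b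
        using wiener_holomorphic_fst[OF that, of x] tx holomorphic_on_imp_differentiable_at[of _ "ball 0 1" t]
        by simp
      then have "deriv (\<lambda>s. u' s x) t = deriv (\<lambda>s. u s x) t + deriv (\<lambda>s. e s x) t"
        unfolding u'_def using u e by (intro deriv_add) auto
      then show ?thesis
        using eq[OF tx] eeq[OF tx] by (simp add: f'_def u'_def v'_def algebra_simps)
    qed
    have "P (Suc n) (u', v', f') \<and> Q n s (u', v', f')"
      unfolding P_def Q_def s using u' v' f' uv' eq' e' w' by (simp add: u'_def v'_def)
    then show "\<exists>s'. P (Suc n) s' \<and> Q n s s'" by blast
  qed
  then obtain s where s: "\<And>n. P n (s n)" "\<And>n. Q n (s n) (s (Suc n))" by blast
  define u v f where "u n = fst (s n)" and "v n = fst (snd (s n))" and "f n = snd (snd (s n))" for n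
  have sn: "s n = (u n, v n, f n)" for n
    by (simp add: u_def v_def f_def)
  have u: "wiener (u n) ((1 - (1 / 2) ^ n) / 2)" and v: "wiener (v n) ((1 - (1 / 2) ^ n) / 2)"
    and f: "wiener (f n) (\<epsilon> * (1 / 2) ^ n)"
    and uv: "\<And>t x. norm t \<le> 1 \<Longrightarrow> norm x < 1 \<Longrightarrow> (u n t has_field_derivative v n t x) (at x)"
    and eq: "\<And>t x. norm t < 1 \<Longrightarrow> norm x < 1 \<Longrightarrow> t * deriv (\<lambda>s. u n s x) t =
      lam * u n t x + c * x * v n t x + K t x (u n t x) (v n t x) - f n t x" for n
    using s(1)[of n] unfolding P_def sn by auto
  have du: "wiener (\<lambda>t x. u (Suc n) t x - u n t x) ((1 / 2) ^ n / 4)"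
    and dv: "wiener (\<lambda>t x. v (Suc n) t x - v n t x) ((1 / 2) ^ n / 4)" for n
    using s(2)[of n] unfolding Q_def sn by auto
  have one: "(1 - (1 / 2) ^ n) / 2 \<le> (1 :: real)" for n
  proof -
    have "0 \<le> (1 / 2 :: real) ^ n" by simp
    then show ?thesis by (simp only: field_simps)
  qed
  have u1: "wiener (u n) 1" and v1: "wiener (v n) 1" for n
    using u v one wiener_mono by blast+
  define S where "S = cball (0::complex) 1 \<times> cball (0::complex) 1"
  have lim_ex: "\<exists>G. uniform_limit S (\<lambda>n p. g n (fst p) (snd p)) G sequentially"
    if "\<And>n. wiener (\<lambda>t x. g (Suc n) t x - g n t x) ((1 / 2) ^ n / 4)" for g
  proof (rule geometric_uniform_limit)
    fix n p assume "p \<in> S"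
    then have "norm (g (Suc n) (fst p) (snd p) - g n (fst p) (snd p)) \<le> (1 / 2) ^ n / 4"
      using wiener_norm_le[OF that[of n], of "fst p" "snd p"] by (auto simp: S_def)
    also have "\<dots> \<le> (1 / 2) ^ n" by simp
    finally show "norm (g (Suc n) (fst p) (snd p) - g n (fst p) (snd p)) \<le> (1 / 2) ^ n" .
  qed
  obtain U0 where U0: "uniform_limit S (\<lambda>n p. u n (fst p) (snd p)) U0 sequentially"
    using lim_ex[OF du] by blast
  obtain V0 where V0: "uniform_limit S (\<lambda>n p. v n (fst p) (snd p)) V0 sequentially"
    using lim_ex[OF dv] by blast
  define Y V where "Y t x = U0 (t, x)" and "V t x = V0 (t, x)" for t x
  have Ylim: "(\<lambda>n. u n t x) \<longlonglongrightarrow> Y t x" and Vlim: "(\<lambda>n. v n t x) \<longlonglongrightarrow> V t x"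
    if "norm t \<le> 1" "norm x \<le> 1" for t x
    using tendsto_uniform_limitI[OF U0, of "(t, x)"] tendsto_uniform_limitI[OF V0, of "(t, x)"] that
    by (simp_all add: S_def Y_def V_def)
  have Ybd: "norm (Y t x) \<le> 1" if "norm t \<le> 1" "norm x \<le> 1" for t x
    by (rule tendsto_upperbound[OF tendsto_norm[OF Ylim[OF that]]])
      (use wiener_norm_le[OF u1] that in auto)
  have Vbd: "norm (V t x) \<le> 1" if "norm t \<le> 1" "norm x \<le> 1" for t x
    by (rule tendsto_upperbound[OF tendsto_norm[OF Vlim[OF that]]])
      (use wiener_norm_le[OF v1] that in auto)
  have Vcont: "continuous_on S (\<lambda>(t, x). V t x)"
  proof -
    have "continuous_on S (\<lambda>p. v n (fst p) (snd p))" for n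
      using wiener_continuous[OF v1[of n]] by (simp add: S_def case_prod_unfold)
    then have "continuous_on S V0"
      by (intro uniform_limit_theorem[OF _ V0]) auto
    then show ?thesis
      by (simp add: V_def case_prod_unfold)
  qed
  have Yx: "(Y t has_field_derivative V t x) (at x)" if tx: "norm t \<le> 1" "norm x < 1" for t x
  proof -
    have "\<exists>g'. \<forall>x\<in>ball 0 1. (Y t has_field_derivative g' x) (at x) \<and> (\<lambda>n. v n t x) \<longlonglongrightarrow> g' x"
    proof (rule has_complex_derivative_uniform_sequence)
      fix x :: complex assume "x \<in> ball 0 1"
      then obtain d where d: "d > 0" "cball x d \<subseteq> ball 0 1"
        using open_contains_cball open_ball by blast
      have "Pair t \<in> cball x d \<rightarrow> S"
        using d(2) tx ball_subset_cball[of "0 :: complex" 1] by (auto simp: S_def subset_iff)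
      from uniform_limit_compose'[OF U0 this]
      have "uniform_limit (cball x d) (\<lambda>n x. u n t x) (Y t) sequentially"
        by (simp add: Y_def[abs_def])
      then show "\<exists>d>0. cball x d \<subseteq> ball 0 1 \<and> uniform_limit (cball x d) (\<lambda>n. u n t) (Y t) sequentially"
        using d by blast
    qed (use uv tx in auto)
    then obtain g' where "\<forall>x\<in>ball 0 1. (Y t has_field_derivative g' x) (at x) \<and> (\<lambda>n. v n t x) \<longlonglongrightarrow> g' x"
      by blast
    then have g': "(Y t has_field_derivative g' x) (at x)" "(\<lambda>n. v n t x) \<longlonglongrightarrow> g' x"
      using tx by auto
    moreover have "g' x = V t x"
      using LIMSEQ_unique[OF g'(2) Vlim] tx by simp
    ultimately show ?thesis by simp
  qed
  \<comment> \<open>For fixed x the iterates converge locally uniformly in t, so their t-derivatives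
    converge as well. The equation with its defect passes to the limit pointwise, \<open>K\<close>
    by its Lipschitz bound.\<close>
  have Yt: "((\<lambda>s. Y s x) has_field_derivative deriv (\<lambda>s. Y s x) t) (at t) \<and>
      t * deriv (\<lambda>s. Y s x) t = lam * Y t x + c * x * V t x + K t x (Y t x) (V t x)"
    if tx: "norm t < 1" "norm x < 1" for t x
  proof -
    have "\<exists>g'. \<forall>t\<in>ball 0 1. ((\<lambda>s. Y s x) has_field_derivative g' t) (at t) \<and>
        (\<lambda>n. deriv (\<lambda>s. u n s x) t) \<longlonglongrightarrow> g' t"
    proof (rule has_complex_derivative_uniform_sequence)
      show "((\<lambda>s. u n s x) has_field_derivative deriv (\<lambda>s. u n s x) t) (at t)" if "t \<in> ball 0 1" for n t
        using wiener_holomorphic_fst[OF u1[of n], of x] tx that holomorphic_derivI[of _ "ball 0 1" t] by simp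
      fix t :: complex assume "t \<in> ball 0 1"
      then obtain d where d: "d > 0" "cball t d \<subseteq> ball 0 1"
        using open_contains_cball open_ball by blast
      have "(\<lambda>t. (t, x)) \<in> cball t d \<rightarrow> S"
        using d(2) tx ball_subset_cball[of "0 :: complex" 1] by (auto simp: S_def subset_iff)
      from uniform_limit_compose'[OF U0 this]
      have "uniform_limit (cball t d) (\<lambda>n t. u n t x) (\<lambda>t. Y t x) sequentially"
        by (simp add: Y_def)
      then show "\<exists>d>0. cball t d \<subseteq> ball 0 1 \<and>
          uniform_limit (cball t d) (\<lambda>n t. u n t x) (\<lambda>t. Y t x) sequentially"
        using d by blast
    qed auto
    then obtain g' where "\<forall>t\<in>ball 0 1. ((\<lambda>s. Y s x) has_field_derivative g' t) (at t) \<and>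
        (\<lambda>n. deriv (\<lambda>s. u n s x) t) \<longlonglongrightarrow> g' t"
      by blast
    then have g': "((\<lambda>s. Y s x) has_field_derivative g' t) (at t)"
        "(\<lambda>n. deriv (\<lambda>s. u n s x) t) \<longlonglongrightarrow> g' t"
      using tx by auto
    have D: "deriv (\<lambda>s. Y s x) t = g' t"
      by (rule DERIV_imp_deriv[OF g'(1)])
    have le: "norm t \<le> 1" "norm x \<le> 1" using tx by auto
    have "(\<lambda>n. K t x (u n t x) (v n t x) - K t x (Y t x) (V t x)) \<longlonglongrightarrow> 0"
    proof (rule Lim_null_comparison)
      show "\<forall>\<^sub>F n in sequentially. norm (K t x (u n t x) (v n t x) - K t x (Y t x) (V t x)) \<le>
          \<epsilon> * max (norm (u n t x - Y t x)) (norm (v n t x - V t x))"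
        by (intro always_eventually allI small_series_lipschitz[OF K] le Ybd Vbd
            wiener_norm_le[OF u1] wiener_norm_le[OF v1])
      have "(\<lambda>n. \<epsilon> * max (norm (u n t x - Y t x)) (norm (v n t x - V t x))) \<longlonglongrightarrow>
          \<epsilon> * max (norm (Y t x - Y t x)) (norm (V t x - V t x))"
        by (intro tendsto_intros Ylim Vlim le)
      then show "(\<lambda>n. \<epsilon> * max (norm (u n t x - Y t x)) (norm (v n t x - V t x))) \<longlonglongrightarrow> 0"
        by simp
    qed
    then have Klim: "(\<lambda>n. K t x (u n t x) (v n t x)) \<longlonglongrightarrow> K t x (Y t x) (V t x)"
      by (simp add: LIM_zero_iff)
    have flim: "(\<lambda>n. f n t x) \<longlonglongrightarrow> 0"
    proof (rule Lim_null_comparison)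
      show "\<forall>\<^sub>F n in sequentially. norm (f n t x) \<le> \<epsilon> * (1 / 2) ^ n"
        by (intro always_eventually allI wiener_norm_le[OF f] le)
      have "(\<lambda>n. \<epsilon> * (1 / 2) ^ n) \<longlonglongrightarrow> \<epsilon> * 0"
        by (intro tendsto_intros LIMSEQ_power_zero) auto
      then show "(\<lambda>n. \<epsilon> * (1 / 2) ^ n) \<longlonglongrightarrow> 0" by simp
    qed
    have "(\<lambda>n. t * deriv (\<lambda>s. u n s x) t) \<longlonglongrightarrow> t * g' t"
      by (intro tendsto_intros g')
    moreover have "(\<lambda>n. t * deriv (\<lambda>s. u n s x) t) \<longlonglongrightarrow>
        lam * Y t x + c * x * V t x + K t x (Y t x) (V t x) - 0"
      unfolding eq[OF tx] by (intro tendsto_intros Ylim Vlim le Klim flim)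
    ultimately have "t * g' t = lam * Y t x + c * x * V t x + K t x (Y t x) (V t x)"
      using LIMSEQ_unique by fastforce
    then show ?thesis using D g'(1) by simp
  qed
  show ?thesis
  proof (rule that[of Y "\<lambda>t x. deriv (\<lambda>s. Y s x) t" V])
    fix t x :: complex assume tx: "norm t < 1" "norm x < 1"
    show "((\<lambda>(t, x). Y t x) has_derivative (\<lambda>(h, k). deriv (\<lambda>s. Y s x) t * h + V t x * k)) (at (t, x))"
    proof (rule has_derivative_complex_partials[of "ball 0 1" "ball 0 1"])
      show "continuous_on (ball 0 1 \<times> ball 0 1) (\<lambda>(t, x). V t x)"
        by (rule continuous_on_subset[OF Vcont]) (auto simp: S_def)
    qed (use tx Yt Yx in auto)
    show "t * deriv (\<lambda>s. Y s x) t = lam * Y t x + c * x * V t x + K t x (Y t x) (V t x)"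
      using Yt[OF tx] by simp
    show "norm (Y t x) \<le> 1 \<and> norm (V t x) \<le> 1"
      using Ybd Vbd tx by simp
  qed
qed

section \<open>Rescaling\<close>

lemma taylor_coeff_0 [simp]: "taylor_coeff f 0 = f 0"
  and taylor_coeff_1: "taylor_coeff f (Suc 0) = deriv f 0"
  by (simp_all add: taylor_coeff_def)

lemma has_derivative_along_line:
  fixes F :: "complex \<times> complex \<times> complex \<times> complex \<Rightarrow> complex"
  assumes "(F has_derivative (\<lambda>(h, k, l, m). a * h + b * k + c * l + d * m))
    (at (p1 + s * q1, p2 + s * q2, p3 + s * q3, p4 + s * q4))"
  shows "((\<lambda>s. F (p1 + s * q1, p2 + s * q2, p3 + s * q3, p4 + s * q4)) has_field_derivative
    (a * q1 + b * q2 + c * q3 + d * q4)) (at s)"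
proof -
  have "((\<lambda>s. (p1 + s * q1, p2 + s * q2, p3 + s * q3, p4 + s * q4)) has_derivative
      (\<lambda>h. (h * q1, h * q2, h * q3, h * q4))) (at s)"
    by (intro has_derivative_Pair) (auto intro!: derivative_eq_intros)
  from diff_chain_at[OF this assms]
  show ?thesis
    unfolding has_field_derivative_def o_def
    by (rule has_derivative_eq_rhs) (simp add: fun_eq_iff algebra_simps)
qed

text \<open>Covers both uses of one-variable theory: separate holomorphy in each variable, and
  holomorphy along the ray through (0, x, 0, 0) in the direction (0, 0, y, z).\<close>

lemma holomorphic4_on_line:
  assumes "holomorphic4_on F \<Delta>"
    and "\<And>s. s \<in> S \<Longrightarrow> (p1 + s * q1, p2 + s * q2, p3 + s * q3, p4 + s * q4) \<in> \<Delta>"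
  shows "(\<lambda>s. F (p1 + s * q1, p2 + s * q2, p3 + s * q3, p4 + s * q4)) holomorphic_on S"
proof (rule holomorphic_onI)
  fix s assume "s \<in> S"
  then obtain a b c d where "(F has_derivative (\<lambda>(h, k, l, m). a * h + b * k + c * l + d * m))
    (at (p1 + s * q1, p2 + s * q2, p3 + s * q3, p4 + s * q4))"
    using assms unfolding holomorphic4_on_def by blast
  from has_derivative_along_line[OF this]
  show "(\<lambda>s. F (p1 + s * q1, p2 + s * q2, p3 + s * q3, p4 + s * q4)) field_differentiable at s within S"
    using field_differentiable_at_within field_differentiable_def by blast
qed

lemma holomorphic2_partials:
  fixes f :: "complex \<times> complex \<Rightarrow> complex"
  assumes "(f has_derivative (\<lambda>(h, k). a * h + b * k)) (at (t, x))"
  shows "((\<lambda>s. f (s, x)) has_field_derivative a) (at t)"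
    and "((\<lambda>y. f (t, y)) has_field_derivative b) (at x)"
proof -
  have "((\<lambda>s. (s, x)) has_derivative (\<lambda>h. (h, 0))) (at t)"
    by (auto intro!: derivative_eq_intros)
  from diff_chain_at[OF this assms] show "((\<lambda>s. f (s, x)) has_field_derivative a) (at t)"
    unfolding has_field_derivative_def o_def by (simp add: mult_commute_abs)
  have "((\<lambda>y. (t, y)) has_derivative (\<lambda>h. (0, h))) (at x)"
    by (auto intro!: derivative_eq_intros)
  from diff_chain_at[OF this assms] show "((\<lambda>y. f (t, y)) has_field_derivative b) (at x)"
    unfolding has_field_derivative_def o_def by (simp add: mult_commute_abs)
qed

lemma has_derivative_rescale:
  fixes f :: "complex \<times> complex \<Rightarrow> complex"
  assumes "(f has_derivative (\<lambda>(h, k). a * h + b * k)) (at (T * t, R * x))"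
  shows "((\<lambda>p. q * f (T * fst p, R * snd p)) has_derivative (\<lambda>(h, k). (q * a * T) * h + (q * b * R) * k)) (at (t, x))"
proof -
  have "((\<lambda>p. (T * fst p, R * snd p)) has_derivative (\<lambda>p. (T * fst p, R * snd p))) (at (t, x))"
    by (auto intro!: derivative_eq_intros)
  moreover have "(f has_derivative (\<lambda>(h, k). a * h + b * k)) (at ((\<lambda>p. (T * fst p, R * snd p)) (t, x)))"
    using assms by simp
  ultimately have "((\<lambda>p. f (T * fst p, R * snd p)) has_derivative (\<lambda>p. a * (T * fst p) + b * (R * snd p))) (at (t, x))"
    using diff_chain_at by (fastforce simp: o_def)
  from has_derivative_mult_right[OF this, of q] show ?thesis
    by (rule has_derivative_eq_rhs) (auto simp: fun_eq_iff algebra_simps)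
qed

text \<open>Two one-variable Taylor estimates: first order in t, then second order along the ray
  from (0, x, 0, 0) to (0, x, y, z), where \<open>F0\<close> removes the constant term. The ray
  parameter may range over |s| < \<open>\<rho>0 / m\<close>, so the remainder at s = 1 is quadratic
  in \<open>m / \<rho>\<close>.\<close>

lemma linearization_error:
  fixes F :: "complex \<times> complex \<times> complex \<times> complex \<Rightarrow> complex"
  assumes hol: "holomorphic4_on F \<Delta>"
    and poly: "\<And>t x y z. norm t < \<rho>0 \<Longrightarrow> norm x < \<rho>0 \<Longrightarrow> norm y < \<rho>0 \<Longrightarrow> norm z < \<rho>0 \<Longrightarrow>
      (t, x, y, z) \<in> \<Delta> \<and> norm (F (t, x, y, z)) \<le> M"
    and F0: "F (0, x, 0, 0) = 0"
    and \<rho>: "0 < \<rho>" "\<rho> < \<rho>0" and m: "0 < m" "m \<le> \<rho> / 2"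
    and t: "norm t \<le> \<rho> / 2" and x: "norm x < \<rho>0" and y: "norm y \<le> m" and z: "norm z \<le> m"
  shows "norm (F (t, x, y, z) - deriv (\<lambda>y. F (0, x, y, 0)) 0 * y - deriv (\<lambda>v. F (0, x, 0, v)) 0 * z)
    \<le> 2 * M * (norm t / \<rho>) + 2 * M * (m / \<rho>)\<^sup>2"
proof -
  have yz: "norm y < \<rho>0" "norm z < \<rho>0" using y z m \<rho> by linarith+
  have 1: "norm (F (t, x, y, z) - F (0, x, y, z)) \<le> 2 * M * (norm t / \<rho>)"
  proof -
    have "(\<lambda>t. F (t, x, y, z)) holomorphic_on ball 0 \<rho>0"
      using holomorphic4_on_line[OF hol, of "ball 0 \<rho>0" 0 1 x 0 y 0 z 0] poly x yz by simp
    from taylor_remainder[OF this _ t \<rho>, of M 1] show ?thesis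
      using poly x yz by simp
  qed
  have 2: "norm (F (0, x, y, z) - deriv (\<lambda>y. F (0, x, y, 0)) 0 * y - deriv (\<lambda>v. F (0, x, 0, v)) 0 * z)
      \<le> 2 * M * (m / \<rho>)\<^sup>2"
  proof -
    define \<phi> where "\<phi> s = F (0, x, s * y, s * z)" for s
    have lt: "norm (s * y) < \<rho>0" "norm (s * z) < \<rho>0" if "norm s < \<rho>0 / m" for s
    proof -
      have "norm s * m < \<rho>0" using that m by (simp add: pos_less_divide_eq)
      then show "norm (s * y) < \<rho>0" "norm (s * z) < \<rho>0"
        using mult_left_mono[OF y, of "norm s"] mult_left_mono[OF z, of "norm s"]
        by (simp_all add: norm_mult)
    qed
    have \<phi>hol: "\<phi> holomorphic_on ball 0 (\<rho>0 / m)"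
      unfolding \<phi>_def[abs_def]
      using holomorphic4_on_line[OF hol, of "ball 0 (\<rho>0 / m)" 0 0 x 0 0 y 0 z] poly x lt \<rho> by simp
    have "(0, x, 0, 0) \<in> \<Delta>" using poly x \<rho> by simp
    then obtain a b c d where D: "(F has_derivative (\<lambda>(h, k, l, m). a * h + b * k + c * l + d * m)) (at (0, x, 0, 0))"
      using hol unfolding holomorphic4_on_def by blast
    have D': "(F has_derivative (\<lambda>(h, k, l, m). a * h + b * k + c * l + d * m))
        (at (0 + 0 * q1, x + 0 * q2, 0 + 0 * q3, 0 + 0 * q4))" for q1 q2 q3 q4 :: complex
      using D by simp
    have "deriv (\<lambda>y. F (0, x, y, 0)) 0 = c"
      using has_derivative_along_line[OF D'[of 0 0 1 0]] by (simp add: DERIV_imp_deriv)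
    moreover have "deriv (\<lambda>v. F (0, x, 0, v)) 0 = d"
      using has_derivative_along_line[OF D'[of 0 0 0 1]] by (simp add: DERIV_imp_deriv)
    moreover have "deriv \<phi> 0 = c * y + d * z"
      unfolding \<phi>_def[abs_def] using has_derivative_along_line[OF D'[of 0 0 y z]] by (simp add: DERIV_imp_deriv)
    moreover have "\<phi> 0 = 0" using F0 by (simp add: \<phi>_def)
    moreover have "norm (\<phi> 1 - (\<Sum>i<2. taylor_coeff \<phi> i * 1 ^ i)) \<le> 2 * M * (norm (1::complex) / (\<rho> / m)) ^ 2"
    proof (rule taylor_remainder[OF \<phi>hol])
      show "norm (\<phi> s) \<le> M" if "norm s < \<rho>0 / m" for s
        unfolding \<phi>_def using poly x lt[OF that] \<rho> by simp
      show "norm (1::complex) \<le> \<rho> / m / 2" "0 < \<rho> / m" "\<rho> / m < \<rho>0 / m"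
        using m \<rho> by (simp_all add: field_simps divide_strict_right_mono)
    qed
    ultimately show ?thesis
      by (simp add: numeral_2_eq_2 taylor_coeff_1 \<phi>_def algebra_simps)
  qed
  have "norm (F (t, x, y, z) - deriv (\<lambda>y. F (0, x, y, 0)) 0 * y - deriv (\<lambda>v. F (0, x, 0, v)) 0 * z)
      \<le> norm (F (t, x, y, z) - F (0, x, y, z)) +
        norm (F (0, x, y, z) - deriv (\<lambda>y. F (0, x, y, 0)) 0 * y - deriv (\<lambda>v. F (0, x, 0, v)) 0 * z)"
    by (rule order_trans[OF _ norm_triangle_ineq]) (simp add: algebra_simps)
  with 1 2 show ?thesis by linarith
qed

text \<open>The function \<open>K\<close> of the rescaled equation, for \<open>u = \<eta> * R\<^sup>2 * y\<close> and \<open>\<partial>u/\<partial>x = \<eta> * R * z\<close>.\<close>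

definition rescaled :: "(complex \<times> complex \<times> complex \<times> complex \<Rightarrow> complex) \<Rightarrow> complex \<Rightarrow> complex \<Rightarrow>
    real \<Rightarrow> real \<Rightarrow> real \<Rightarrow> complex \<Rightarrow> complex \<Rightarrow> complex \<Rightarrow> complex \<Rightarrow> complex"
  where "rescaled F lam c \<eta> R T t x y z =
    F (of_real T * t, of_real R * x, of_real (\<eta> * R\<^sup>2) * y, of_real (\<eta> * R) * z) / of_real (\<eta> * R\<^sup>2) -
      lam * y - c * x * z"

text \<open>On the polydisc of radius 3 four errors are bounded by multiples of N = \<eta> R^2: e/12
  from lam, e/4 from c, e/3 from the dependence on t and e/3 from the quadratic part. They add up to
  e.\<close>

lemma rescaled_small:
  fixes F :: "complex \<times> complex \<times> complex \<times> complex \<Rightarrow> complex" and c lam :: "complex \<Rightarrow> complex"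
  assumes \<Delta>: "open \<Delta>" "(0, 0, 0, 0) \<in> \<Delta>" and hol: "holomorphic4_on F \<Delta>"
    and F0: "\<And>x. (0, x, 0, 0) \<in> \<Delta> \<Longrightarrow> F (0, x, 0, 0) = 0"
    and c: "isCont c 0" "\<forall>\<^sub>F x in nhds 0. deriv (\<lambda>v. F (0, x, 0, v)) 0 = x * c x"
    and lam: "\<And>x. (0, x, 0, 0) \<in> \<Delta> \<Longrightarrow> lam x = deriv (\<lambda>y. F (0, x, y, 0)) 0"
    and \<epsilon>: "\<epsilon> > 0"
  obtains \<eta> where "\<eta> > 0"
    "\<forall>\<^sub>F R in at_right 0. \<forall>\<^sub>F T in at_right 0. small_series (rescaled F (lam 0) (c 0) \<eta> R T) \<epsilon>"
proof -
  obtain a1 a2 a3 a4 where "(F has_derivative (\<lambda>(h, k, l, m). a1 * h + a2 * k + a3 * l + a4 * m)) (at (0, 0, 0, 0))"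
    using hol \<Delta>(2) unfolding holomorphic4_on_def by blast
  from has_derivative_continuous[OF this]
  have "(F \<longlongrightarrow> F (0, 0, 0, 0)) (nhds (0, 0, 0, 0))"
    by (simp only: isCont_def tendsto_at_iff_tendsto_nhds)
  then have "(F \<longlongrightarrow> 0) (nhds (0, 0, 0, 0))"
    by (simp only: F0[OF \<Delta>(2)])
  from tendstoD[OF this, of 1] have "\<forall>\<^sub>F p in nhds (0, 0, 0, 0). norm (F p) < 1"
    by simp
  moreover have "\<forall>\<^sub>F p in nhds (0, 0, 0, 0). p \<in> \<Delta>"
    using \<Delta> eventually_nhds_in_open by blast
  ultimately have "\<forall>\<^sub>F p in nhds (0, 0, 0, 0). p \<in> \<Delta> \<and> norm (F p) \<le> 1"
    by eventually_elim auto
  then obtain d where d: "d > 0" and dp: "\<And>p. dist p (0, 0, 0, 0) < d \<Longrightarrow> p \<in> \<Delta> \<and> norm (F p) \<le> 1"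
    unfolding eventually_nhds_metric by blast
  \<comment> \<open>A quarter of \<open>d\<close>, because the norm of a quadruple is at most the
    sum of its four moduli.\<close>
  define \<rho>0 where "\<rho>0 = d / 4"
  define \<rho> where "\<rho> = \<rho>0 / 2"
  have \<rho>: "0 < \<rho>" "\<rho> < \<rho>0" using d by (simp_all add: \<rho>_def \<rho>0_def)
  have poly: "(t, x, y, z) \<in> \<Delta> \<and> norm (F (t, x, y, z)) \<le> 1"
    if "norm t < \<rho>0" "norm x < \<rho>0" "norm y < \<rho>0" "norm z < \<rho>0" for t x y z
  proof (rule dp)
    have "dist (t, x, y, z) (0, 0, 0, 0) \<le> norm t + norm (x, y, z)"
      by (simp add: dist_norm norm_Pair_le)
    also have "norm (x, y, z) \<le> norm x + norm (y, z)"
      by (rule norm_Pair_le)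
    also have "norm (y, z) \<le> norm y + norm z"
      by (rule norm_Pair_le)
    finally show "dist (t, x, y, z) (0, 0, 0, 0) < d"
      using that by (simp add: \<rho>0_def)
  qed
  \<comment> \<open>Compensates the factor \<open>majorant_const\<close> from
    \<open>small_seriesI\<close>; the added 1 keeps the denominator positive.\<close>
  define e where "e = \<epsilon> / (majorant_const + 1)"
  have e: "e > 0" "e * majorant_const \<le> \<epsilon>"
    using \<epsilon> majorant_const_nonneg by (simp_all add: e_def field_simps)
  \<comment> \<open>Near 0, \<open>lam\<close> is the first Taylor coefficient of F (0, x, y, 0) in
    y, hence holomorphic in x by \<open>taylor_coeff_param_holomorphic\<close>.\<close>
  have "isCont lam 0"
  proof -
    have "(\<lambda>x. taylor_coeff (\<lambda>y. F (0, x, y, 0)) 1) holomorphic_on ball 0 \<rho>0"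
    proof (rule taylor_coeff_param_holomorphic[where f = "\<lambda>y x. F (0, x, y, 0)" and r = \<rho>0 and M = 1])
      show "(\<lambda>y. F (0, x, y, 0)) holomorphic_on ball 0 \<rho>0" if "x \<in> ball 0 \<rho>0" for x
        using holomorphic4_on_line[OF hol, of "ball 0 \<rho>0" 0 0 x 0 0 1 0 0] poly that \<rho> by simp
      show "(\<lambda>x. F (0, x, y, 0)) holomorphic_on ball 0 \<rho>0" if "norm y < \<rho>0" for y
        using holomorphic4_on_line[OF hol, of "ball 0 \<rho>0" 0 0 0 1 y 0 0 0] poly that \<rho> by simp
    qed (use poly \<rho> in auto)
    then have "lam holomorphic_on ball 0 \<rho>0"
      by (rule holomorphic_transform) (use lam poly \<rho> in \<open>simp add: taylor_coeff_1\<close>)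
    then have "continuous_on (ball 0 \<rho>0) lam"
      by (rule holomorphic_on_imp_continuous_on)
    then show ?thesis
      using \<rho> by (simp add: continuous_on_eq_continuous_at)
  qed
  then have "\<forall>\<^sub>F x in nhds 0. dist (lam x) (lam 0) < e / 36"
    unfolding isCont_def tendsto_at_iff_tendsto_nhds using e by (intro tendstoD) auto
  moreover have "\<forall>\<^sub>F x in nhds 0. dist (c x) (c 0) < e / 36"
    using c(1) unfolding isCont_def tendsto_at_iff_tendsto_nhds using e by (intro tendstoD) auto
  ultimately have "\<forall>\<^sub>F x in nhds 0. norm (lam x - lam 0) \<le> e / 36 \<and> norm (c x - c 0) \<le> e / 36 \<and>
      deriv (\<lambda>v. F (0, x, 0, v)) 0 = x * c x"
    using c(2) by eventually_elim (auto simp: dist_norm)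
  then obtain r1 where r1: "r1 > 0" and near: "\<And>x. norm x < r1 \<Longrightarrow>
      norm (lam x - lam 0) \<le> e / 36 \<and> norm (c x - c 0) \<le> e / 36 \<and> deriv (\<lambda>v. F (0, x, 0, v)) 0 = x * c x"
    unfolding eventually_nhds_metric by auto
  \<comment> \<open>The quadratic part is at most 2 (3 \<eta> R / \<rho>)^2 = (18 \<eta> / \<rho>^2)
    N, with no power of R to spare; the constant 54 = 3 * 18 turns this into e/3 times N.\<close>
  define \<eta> where "\<eta> = min 1 (e * \<rho>\<^sup>2 / 54)"
  have \<eta>: "0 < \<eta>" "\<eta> \<le> 1" "\<eta> \<le> e * \<rho>\<^sup>2 / 54"
    using e \<rho> by (auto simp: \<eta>_def)
  \<comment> \<open>Radius 3 explains the constants: R and T below \<open>\<rho> / 6\<close> keep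
    the scaled variables within \<open>\<rho> / 2\<close>, and 18 = 2 * 3 * 3 makes the error from t
    at most e/3 times N.\<close>
  have main: "small_series (rescaled F (lam 0) (c 0) \<eta> R T) \<epsilon>"
    if R: "0 < R" "R < 1" "R < r1 / 3" "R < \<rho> / 6" and T: "0 < T" "T < \<rho> / 6" "T < e * \<rho> * (\<eta> * R\<^sup>2) / 18" for R T
  proof -
    have \<eta>R: "0 < \<eta> * R" "\<eta> * R \<le> R" "0 < \<eta> * R\<^sup>2" "\<eta> * R\<^sup>2 \<le> \<eta> * R"
      using \<eta> R by (auto simp: power2_eq_square mult_left_le mult_right_le_one_le mult_left_le_one_le)
    have sc: "norm (of_real a * w :: complex) < 3 * a" if "norm w < 3" "0 < a" for a and w :: complex
      using that by (simp add: norm_mult)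
    have in_poly: "norm (of_real T * t) < \<rho> / 2 \<and> norm (of_real R * x) < \<rho>0 \<and> norm (of_real R * x) < r1 \<and>
        norm (of_real (\<eta> * R\<^sup>2) * y) < 3 * (\<eta> * R\<^sup>2) \<and> norm (of_real (\<eta> * R) * z) < 3 * (\<eta> * R)"
      if "norm t < 3" "norm x < 3" "norm y < 3" "norm z < 3" for t x y z :: complex
      using sc[OF that(1) T(1)] sc[OF that(2) R(1)] sc[OF that(3) \<eta>R(3)] sc[OF that(4) \<eta>R(1)] T R \<rho> by auto
    have m: "3 * (\<eta> * R) \<le> \<rho> / 2" "3 * (\<eta> * R) < \<rho>0" "3 * (\<eta> * R\<^sup>2) < \<rho>0"
      using \<eta>R R \<rho> by linarith+
    have in_\<Delta>: "(of_real T * t, of_real R * x, of_real (\<eta> * R\<^sup>2) * y, of_real (\<eta> * R) * z) \<in> \<Delta>"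
      if "norm t < 3" "norm x < 3" "norm y < 3" "norm z < 3" for t x y z :: complex
      by (rule poly[THEN conjunct1]) (use in_poly[OF that] m \<rho> in linarith)+
    have "small_series (rescaled F (lam 0) (c 0) \<eta> R T) (e * majorant_const)"
    proof (rule small_seriesI)
      show "(\<lambda>t. rescaled F (lam 0) (c 0) \<eta> R T t x y z) holomorphic_on ball 0 3"
        if "norm x < 3" "norm y < 3" "norm z < 3" for x y z
        unfolding rescaled_def
        using holomorphic4_on_line[OF hol, of "ball 0 3" 0 "of_real T" "of_real R * x" 0
          "of_real (\<eta> * R\<^sup>2) * y" 0 "of_real (\<eta> * R) * z" 0] in_\<Delta> that \<eta>R
        by (intro holomorphic_intros) (auto simp: mult.commute)
      show "(\<lambda>x. rescaled F (lam 0) (c 0) \<eta> R T t x y z) holomorphic_on ball 0 3"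
        if "norm t < 3" "norm y < 3" "norm z < 3" for t y z
        unfolding rescaled_def
        using holomorphic4_on_line[OF hol, of "ball 0 3" "of_real T * t" 0 0 "of_real R"
          "of_real (\<eta> * R\<^sup>2) * y" 0 "of_real (\<eta> * R) * z" 0] in_\<Delta> that \<eta>R
        by (intro holomorphic_intros) (auto simp: mult.commute)
      show "(\<lambda>y. rescaled F (lam 0) (c 0) \<eta> R T t x y z) holomorphic_on ball 0 3"
        if "norm t < 3" "norm x < 3" "norm z < 3" for t x z
        unfolding rescaled_def
        using holomorphic4_on_line[OF hol, of "ball 0 3" "of_real T * t" 0 "of_real R * x" 0
          0 "of_real (\<eta> * R\<^sup>2)" "of_real (\<eta> * R) * z" 0] in_\<Delta> that \<eta>R
        by (intro holomorphic_intros) (auto simp: mult.commute)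
      show "(\<lambda>z. rescaled F (lam 0) (c 0) \<eta> R T t x y z) holomorphic_on ball 0 3"
        if "norm t < 3" "norm x < 3" "norm y < 3" for t x y
        unfolding rescaled_def
        using holomorphic4_on_line[OF hol, of "ball 0 3" "of_real T * t" 0 "of_real R * x" 0
          "of_real (\<eta> * R\<^sup>2) * y" 0 0 "of_real (\<eta> * R)"] in_\<Delta> that \<eta>R
        by (intro holomorphic_intros) (auto simp: mult.commute)
      fix t x y z :: complex
      assume lt: "norm t < 3" "norm x < 3" "norm y < 3" "norm z < 3"
      note ip = in_poly[OF lt]
      define t' x' y' z' where "t' = of_real T * t" and "x' = of_real R * x"
        and "y' = of_real (\<eta> * R\<^sup>2) * y" and "z' = of_real (\<eta> * R) * z"
      define N where "N = \<eta> * R\<^sup>2"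
      have N: "N > 0" using \<eta>R by (simp add: N_def)
      have t': "norm t' \<le> \<rho> / 2" "norm t' \<le> 3 * T" and x': "norm x' < \<rho>0" "norm x' < r1" "norm x' \<le> 3 * R"
        and y': "norm y' \<le> 3 * (\<eta> * R)" "norm y' \<le> 3 * N" and z': "norm z' \<le> 3 * (\<eta> * R)"
        using ip sc[OF lt(1) T(1)] sc[OF lt(2) R(1)] \<eta>R unfolding t'_def x'_def y'_def z'_def N_def by linarith+
      have x\<Delta>: "(0, x', 0, 0) \<in> \<Delta>" using poly[of 0 x' 0 0] x' \<rho> by simp
      note nx = near[OF x'(2)]
      have lin: "norm (F (t', x', y', z') - lam x' * y' - (x' * c x') * z') \<le>
          2 * 1 * (norm t' / \<rho>) + 2 * 1 * (3 * (\<eta> * R) / \<rho>)\<^sup>2"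
        using linearization_error[OF hol poly F0[OF x\<Delta>] \<rho> _ m(1) t'(1) x'(1) y'(1) z'] \<eta>R nx lam[OF x\<Delta>] by simp
      \<comment> \<open>The closeness e/36 is multiplied by |y'| \<le> 3N here and by |x' z'| \<le>
        9N in \<open>l2\<close>.\<close>
      have l1: "norm ((lam x' - lam 0) * y') \<le> e / 12 * N"
        using mult_mono[of "norm (lam x' - lam 0)" "e / 36" "norm y'" "3 * N"] nx y' e
        by (simp add: norm_mult mult_ac)
      have l2: "norm ((c x' - c 0) * (x' * z')) \<le> e / 4 * N"
      proof -
        have "norm (x' * z') \<le> 3 * R * (3 * (\<eta> * R))"
          unfolding norm_mult by (rule mult_mono) (use x' z' R in auto)
        also have "\<dots> = 9 * N" by (simp add: N_def power2_eq_square)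
        finally show ?thesis
          using mult_mono[of "norm (c x' - c 0)" "e / 36" "norm (x' * z')" "9 * N"] nx e
          by (simp add: norm_mult mult_ac)
      qed
      have l3: "2 * 1 * (norm t' / \<rho>) \<le> e / 3 * N"
      proof -
        have "norm t' \<le> e * \<rho> * N / 6" using t' T by (simp add: N_def)
        then show ?thesis using \<rho> by (simp add: field_simps)
      qed
      have l4: "2 * 1 * (3 * (\<eta> * R) / \<rho>)\<^sup>2 \<le> e / 3 * N"
      proof -
        have "2 * 1 * (3 * (\<eta> * R) / \<rho>)\<^sup>2 = 18 * \<eta> / \<rho>\<^sup>2 * N"
          by (simp add: N_def power2_eq_square field_simps)
        also have "\<dots> \<le> e / 3 * N"
          using \<eta> \<rho> N by (intro mult_right_mono) (auto simp: field_simps)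
        finally show ?thesis .
      qed
      have "rescaled F (lam 0) (c 0) \<eta> R T t x y z =
          (F (t', x', y', z') - lam 0 * y' - c 0 * (x' * z')) / of_real N"
        using N \<eta> R unfolding rescaled_def t'_def x'_def y'_def z'_def N_def
        by (simp add: field_simps power2_eq_square)
      also have "\<dots> = ((F (t', x', y', z') - lam x' * y' - (x' * c x') * z') + (lam x' - lam 0) * y' +
          (c x' - c 0) * (x' * z')) / of_real N"
        by (simp add: algebra_simps)
      also have "norm \<dots> \<le> (norm (F (t', x', y', z') - lam x' * y' - (x' * c x') * z') +
          norm ((lam x' - lam 0) * y') + norm ((c x' - c 0) * (x' * z'))) / N"
        using N by (simp add: norm_divide divide_right_mono norm_triangle_le norm_triangle_ineq add_mono)
      also have "\<dots> \<le> e"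
        using lin l1 l2 l3 l4 N by (simp add: pos_divide_le_eq)
      finally show "norm (rescaled F (lam 0) (c 0) \<eta> R T t x y z) \<le> e" .
    qed
    then show ?thesis
      using e(2) unfolding small_series_def by (meson order_trans)
  qed
  have "\<forall>\<^sub>F R in at_right 0. \<forall>\<^sub>F T in at_right 0. small_series (rescaled F (lam 0) (c 0) \<eta> R T) \<epsilon>"
    unfolding eventually_at_right_field
  proof (intro exI conjI allI impI)
    show "0 < min 1 (min (r1 / 3) (\<rho> / 6))" using r1 \<rho> by simp
    fix R assume R: "0 < R" "R < min 1 (min (r1 / 3) (\<rho> / 6))"
    show "0 < min (\<rho> / 6) (e * \<rho> * (\<eta> * R\<^sup>2) / 18)" using \<rho> e \<eta> R by simp
    fix T assume "0 < T" "T < min (\<rho> / 6) (e * \<rho> * (\<eta> * R\<^sup>2) / 18)"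
    with R show "small_series (rescaled F (lam 0) (c 0) \<eta> R T) \<epsilon>"
      by (intro main) auto
  qed
  then show ?thesis using that \<eta>(1) by blast
qed

section \<open>The theorem\<close>

text \<open>\<open>Lim\<close> is a definite description, so the limit must be shown to exist before
  its value can be used. It does exist in the extended reals: the supremum shrinks with \<sigma>,
  and the quotient tends to its infimum over \<sigma> > 0. The upper limit 0 then gives the estimate
  for every small R, not merely along a sequence.\<close>

lemma Limsup_Lim_SUP_small:
  fixes u :: "complex \<times> complex \<Rightarrow> complex"
  assumes lim: "Limsup (at_right (0::real)) (\<lambda>R. Lim (at_right (0::real)) (\<lambda>\<sigma>.
           ereal (1 / R\<^sup>2) *
             (SUP p \<in> (complex_of_real ` {0<..<\<sigma>}) \<times> ball 0 R. ereal (norm (u p))))) = 0"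
    and e: "e > 0"
  shows "\<forall>\<^sub>F R in at_right 0. \<forall>\<^sub>F \<sigma> in at_right (0::real).
    \<forall>t x. 0 < t \<longrightarrow> t < \<sigma> \<longrightarrow> norm x < R \<longrightarrow> norm (u (of_real t, x)) \<le> e * R\<^sup>2"
proof -
  define g where "g R \<sigma> = ereal (1 / R\<^sup>2) *
    (SUP p \<in> (complex_of_real ` {0<..<\<sigma>}) \<times> ball 0 R. ereal (norm (u p)))" for R \<sigma> :: real
  have "\<forall>\<^sub>F R in at_right 0. Lim (at_right 0) (g R) < ereal e"
    by (rule Limsup_lessD) (use lim e in \<open>simp add: g_def[abs_def]\<close>)
  moreover have "\<forall>\<^sub>F R in at_right (0::real). 0 < R"
    by (rule eventually_at_right_less)
  ultimately show ?thesis
  proof eventually_elim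
    case (elim R)
    have mono: "g R a \<le> g R b" if "a \<le> b" for a b
      unfolding g_def using that by (intro ereal_mult_left_mono SUP_subset_mono) auto
    define L where "L = (INF \<sigma>\<in>{0<..}. g R \<sigma>)"
    have "(g R \<longlongrightarrow> L) (at_right 0)"
    proof (rule order_tendstoI)
      fix a assume "a < L"
      then have "a < g R \<sigma>" if "0 < \<sigma>" for \<sigma>
        unfolding L_def using that INF_lower[of \<sigma> "{0<..}" "g R"] by (auto intro: less_le_trans)
      then show "\<forall>\<^sub>F \<sigma> in at_right 0. a < g R \<sigma>"
        using eventually_at_right_less[of 0] by (auto elim!: eventually_mono)
    next
      fix a assume "L < a"
      then obtain \<sigma>1 where "0 < \<sigma>1" "g R \<sigma>1 < a"
        unfolding L_def INF_less_iff by auto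
      then show "\<forall>\<^sub>F \<sigma> in at_right 0. g R \<sigma> < a"
        unfolding eventually_at_right_field
        by (intro exI[of _ \<sigma>1]) (auto intro: le_less_trans[OF mono[OF less_imp_le]])
    qed
    then have "(g R \<longlongrightarrow> Lim (at_right 0) (g R)) (at_right 0)"
      using tendsto_Lim[of "at_right (0::real)" "g R" L] by simp
    then have "\<forall>\<^sub>F \<sigma> in at_right 0. g R \<sigma> < ereal e"
      using elim by (intro order_tendstoD)
    then show ?case
    proof eventually_elim
      case (elim \<sigma>)
      show ?case
      proof (intro allI impI)
        fix t and x :: complex assume "0 < t" "t < \<sigma>" "norm x < R"
        then have "ereal (norm (u (of_real t, x))) \<le>
            (SUP p \<in> (complex_of_real ` {0<..<\<sigma>}) \<times> ball 0 R. ereal (norm (u p)))"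
          by (intro SUP_upper) auto
        then have "ereal (1 / R\<^sup>2) * ereal (norm (u (of_real t, x))) \<le> g R \<sigma>"
          unfolding g_def by (intro ereal_mult_left_mono) auto
        also have "\<dots> < ereal e" by (rule elim)
        finally show "norm (u (of_real t, x)) \<le> e * R\<^sup>2"
          using \<open>0 < R\<close> by (simp add: field_simps)
      qed
    qed
  qed
qed

theorem theorem3p5:
  fixes F :: "complex \<times> complex \<times> complex \<times> complex \<Rightarrow> complex"
    and \<Delta> :: "(complex \<times> complex \<times> complex \<times> complex) set"
    and c lam :: "complex \<Rightarrow> complex"
    and u :: "complex \<times> complex \<Rightarrow> complex"
    and W :: "(complex \<times> complex) set"
    and \<sigma>0 R0 :: real
  assumes "open \<Delta>" and "(0, 0, 0, 0) \<in> \<Delta>"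
    and "holomorphic4_on F \<Delta>"
    and "\<And>x. (0, x, 0, 0) \<in> \<Delta> \<Longrightarrow> F (0, x, 0, 0) = 0"
    and "c analytic_on {0}"
    and "\<forall>\<^sub>F x in nhds 0. deriv (\<lambda>v. F (0, x, 0, v)) 0 = x * c x"
    and "c 0 \<noteq> 0"
    and "\<And>x. (0, x, 0, 0) \<in> \<Delta> \<Longrightarrow> lam x = deriv (\<lambda>y. F (0, x, y, 0)) 0"
    and "Re (c 0) < 0" and "Re (lam 0) < 0"
    and "\<sigma>0 > 0" and "R0 > 0"
    and "open W" and "(complex_of_real ` {0<..<\<sigma>0}) \<times> ball 0 R0 \<subseteq> W"
    and "holomorphic2_on u W"
    and "\<And>t x. (t, x) \<in> W \<Longrightarrow> (t, x, u (t, x), deriv (\<lambda>y. u (t, y)) x) \<in> \<Delta>"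
    and "\<And>t x. (t, x) \<in> W \<Longrightarrow>
           t * deriv (\<lambda>s. u (s, x)) t = F (t, x, u (t, x), deriv (\<lambda>y. u (t, y)) x)"
    and "Limsup (at_right (0::real)) (\<lambda>R. Lim (at_right (0::real)) (\<lambda>\<sigma>.
           ereal (1 / R\<^sup>2) *
             (SUP p \<in> (complex_of_real ` {0<..<\<sigma>}) \<times> ball 0 R. ereal (norm (u p))))) = 0"
  shows "\<exists>V w. open V \<and> (0, 0) \<in> V \<and> holomorphic2_on w V \<and>
           (\<exists>T1>0. \<exists>R1>0. \<forall>p \<in> (complex_of_real ` {0<..<T1}) \<times> ball 0 R1.
              p \<in> V \<and> p \<in> W \<and> w p = u p)"
proof -
  \<comment> \<open>One margin for both real parts; its quarter is the smallness that existence and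
    uniqueness require.\<close>
  define \<delta> where "\<delta> = min (- Re (lam 0)) (- Re (c 0))"
  have \<delta>: "\<delta> > 0" "Re (lam 0) \<le> - \<delta>" "Re (c 0) \<le> - \<delta>"
    using assms(9,10) by (auto simp: \<delta>_def)
  have "isCont c 0"
    using assms(5) analytic_at_imp_isCont by blast
  then obtain \<eta> where \<eta>: "\<eta> > 0"
    and small: "\<forall>\<^sub>F R in at_right 0. \<forall>\<^sub>F T in at_right 0. small_series (rescaled F (lam 0) (c 0) \<eta> R T) (\<delta> / 4)"
    using rescaled_small[OF assms(1-4) _ assms(6,8), of "\<delta> / 4"] \<delta>(1) by auto
  obtain r1 where r1: "0 < r1"
    and small1: "\<And>R. 0 < R \<Longrightarrow> R < r1 \<Longrightarrow> \<forall>\<^sub>F T in at_right 0. small_series (rescaled F (lam 0) (c 0) \<eta> R T) (\<delta> / 4)"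
    using small unfolding eventually_at_right_field by blast
  have "\<forall>\<^sub>F R in at_right 0. \<forall>\<^sub>F \<sigma> in at_right (0::real).
      \<forall>t x. 0 < t \<longrightarrow> t < \<sigma> \<longrightarrow> norm x < R \<longrightarrow> norm (u (of_real t, x)) \<le> \<eta> / 4 * R\<^sup>2"
    by (rule Limsup_Lim_SUP_small[OF assms(18)]) (use \<eta> in simp)
  then obtain r2 where r2: "0 < r2"
    and bd2: "\<And>R. 0 < R \<Longrightarrow> R < r2 \<Longrightarrow> \<forall>\<^sub>F \<sigma> in at_right (0::real).
      \<forall>t x. 0 < t \<longrightarrow> t < \<sigma> \<longrightarrow> norm x < R \<longrightarrow> norm (u (of_real t, x)) \<le> \<eta> / 4 * R\<^sup>2"
    unfolding eventually_at_right_field[of _ 0] by blast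
  \<comment> \<open>Dividing by 3 keeps 2R below \<open>r2\<close> and \<open>R0\<close>. The
    estimate is used on discs of radius 2R to leave room for Cauchy's estimate, and the factor 1/4
    in it makes the bound there exactly N = \<eta> R^2.\<close>
  define R where "R = min r1 (min r2 R0) / 3"
  have R: "0 < R" "R < r1" "2 * R < r2" "2 * R < R0"
    using r1 r2 assms(12) by (auto simp: R_def)
  have "\<forall>\<^sub>F T in at_right 0. small_series (rescaled F (lam 0) (c 0) \<eta> R T) (\<delta> / 4) \<and>
      (\<forall>t x. 0 < t \<longrightarrow> t < T \<longrightarrow> norm x < 2 * R \<longrightarrow> norm (u (of_real t, x)) \<le> \<eta> / 4 * (2 * R)\<^sup>2) \<and>
      0 < T \<and> T < \<sigma>0"
    using small1[OF R(1,2)] bd2[OF _ R(3)] R(1) eventually_at_right_less[of 0]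
      eventually_at_right_real[OF assms(11)]
    by (auto elim: eventually_elim2 intro: eventually_conj)
  then obtain T where K: "small_series (rescaled F (lam 0) (c 0) \<eta> R T) (\<delta> / 4)"
    and ule: "\<And>t x. 0 < t \<Longrightarrow> t < T \<Longrightarrow> norm x < 2 * R \<Longrightarrow> norm (u (of_real t, x)) \<le> \<eta> / 4 * (2 * R)\<^sup>2"
    and T: "0 < T" "T < \<sigma>0"
    using eventually_happens'[OF trivial_limit_at_right_real] by blast
  define N where "N = \<eta> * R\<^sup>2"
  have N: "N > 0" "\<eta> / 4 * (2 * R)\<^sup>2 = N"
    using \<eta> R by (simp_all add: N_def power2_eq_square)
  have inW: "(of_real t, x) \<in> W" if "0 < t" "t < T" "norm x < 2 * R" for t x
  proof -
    have "(complex_of_real t, x) \<in> (complex_of_real ` {0<..<\<sigma>0}) \<times> ball 0 R0"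
      using that T R by auto
    then show ?thesis using assms(14) by blast
  qed
  define ut ux where "ut p = deriv (\<lambda>s. u (s, snd p)) (fst p)" and "ux p = deriv (\<lambda>y. u (fst p, y)) (snd p)"
    for p :: "complex \<times> complex"
  have du: "(u has_derivative (\<lambda>(h, k). ut p * h + ux p * k)) (at p)" if p: "p \<in> W" for p
  proof -
    obtain t x where tx: "p = (t, x)" by fastforce
    obtain a b where ab: "(u has_derivative (\<lambda>(h, k). a * h + b * k)) (at p)"
      using assms(15) p unfolding holomorphic2_on_def by blast
    have "ut p = a" "ux p = b"
      using holomorphic2_partials[of u a b t x] ab by (simp_all add: tx ut_def ux_def DERIV_imp_deriv)
    then show ?thesis using ab by simp
  qed
  \<comment> \<open>Cauchy's estimate on the disc of radius R about x, which lies in |y| < 2R. The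
    result N / R = \<eta> R is the scale of z in \<open>rescaled\<close>.\<close>
  have ux_le: "norm (ux (of_real t, x)) \<le> N / R" if "0 < t" "t < T" "norm x < R" for t x
  proof -
    have sub: "norm y < 2 * R" if "y \<in> cball x R" for y
      using norm_triangle_sub[of y x] that \<open>norm x < R\<close> by (auto simp: dist_norm norm_minus_commute)
    have der: "((\<lambda>y. u (of_real t, y)) has_field_derivative ux (of_real t, y)) (at y)" if "y \<in> cball x R" for y
      using holomorphic2_partials(2) du[OF inW[OF \<open>0 < t\<close> \<open>t < T\<close> sub[OF that]]] by blast
    have "norm ((deriv ^^ 1) (\<lambda>y. u (of_real t, y)) x) \<le> fact 1 * N / R ^ 1"
    proof (rule Cauchy_inequality[OF _ _ R(1)])
      show "(\<lambda>y. u (of_real t, y)) holomorphic_on ball x R"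
        unfolding holomorphic_on_open[OF open_ball] using der ball_subset_cball by blast
      show "continuous_on (cball x R) (\<lambda>y. u (of_real t, y))"
        by (intro continuous_at_imp_continuous_on ballI DERIV_isCont[OF der])
      show "norm (u (of_real t, y)) \<le> N" if "norm (x - y) = R" for y
        using ule[OF \<open>0 < t\<close> \<open>t < T\<close> sub, of y] that N by (simp add: dist_norm)
    qed
    then show ?thesis by (simp add: ux_def)
  qed
  define \<kappa> where "\<kappa> = complex_of_real (1 / N)"
  define y1 where "y1 p = \<kappa> * u (of_real T * fst p, of_real R * snd p)" for p
  define a1 b1 where "a1 t x = \<kappa> * ut (of_real T * of_real t, of_real R * x) * of_real T"
    and "b1 t x = \<kappa> * ux (of_real T * of_real t, of_real R * x) * of_real R" for t :: real and x
  have scaled: "0 < T * t" "T * t < T" "norm (of_real R * x) < R" "norm (of_real R * x) < 2 * R"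
    if "0 < t" "t < 1" "norm x < 1" for t and x :: complex
    using that T R mult_strict_left_mono[of "norm x" 1 R] by (auto simp: norm_mult)
  have sW: "(of_real T * of_real t, of_real R * x) \<in> W" if "0 < t" "t < 1" "norm x < 1" for t x
    using inW[OF scaled(1,2,4)[OF that]] by simp
  obtain Y D V where
    DY: "\<And>t x. norm t < 1 \<Longrightarrow> norm x < 1 \<Longrightarrow>
      ((\<lambda>(t, x). Y t x) has_derivative (\<lambda>(h, k). D t x * h + V t x * k)) (at (t, x))" and
    EY: "\<And>t x. norm t < 1 \<Longrightarrow> norm x < 1 \<Longrightarrow>
      t * D t x = lam 0 * Y t x + c 0 * x * V t x + rescaled F (lam 0) (c 0) \<eta> R T t x (Y t x) (V t x)" and
    BY: "\<And>t x. norm t < 1 \<Longrightarrow> norm x < 1 \<Longrightarrow> norm (Y t x) \<le> 1 \<and> norm (V t x) \<le> 1"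
    by (rule solution_exists[OF K \<delta>]) auto
  \<comment> \<open>The radius 1/2 is the least one that \<open>solution_unique\<close> admits; in
    the original variable it becomes R/2.\<close>
  have eq: "y1 (of_real t, x) = Y (of_real t) x" if tx: "0 < t" "t < 1" "norm x \<le> 1 / 2" for t x
  proof -
    have "y1 (of_real t, x) = (\<lambda>(t, x). Y t x) (of_real t, x)"
    proof (rule solution_unique[OF K \<delta> order_refl, where r = "1 / 2" and ?a1.0 = a1 and ?b1.0 = b1 and
          ?a2.0 = "\<lambda>t. D (of_real t)" and ?b2.0 = "\<lambda>t. V (of_real t)"])
      fix t :: real and x :: complex assume tx: "0 < t" "t < 1" "norm x < 1"
      note p = sW[OF tx]
      have uN: "u (of_real T * of_real t, of_real R * x) = of_real N * y1 (of_real t, x)"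
        using N by (simp add: y1_def \<kappa>_def)
      have uxN: "ux (of_real T * of_real t, of_real R * x) = of_real (\<eta> * R) * b1 t x"
        using N \<eta> R by (simp add: b1_def \<kappa>_def N_def power2_eq_square field_simps)
      show "(y1 has_derivative (\<lambda>(h, k). a1 t x * h + b1 t x * k)) (at (of_real t, x))"
        unfolding y1_def[abs_def] a1_def b1_def by (rule has_derivative_rescale[OF du[OF p]])
      show "((\<lambda>(t, x). Y t x) has_derivative (\<lambda>(h, k). D (of_real t) x * h + V (of_real t) x * k)) (at (of_real t, x))"
        using DY tx by simp
      show "of_real t * a1 t x = lam 0 * y1 (of_real t, x) + c 0 * x * b1 t x +
          rescaled F (lam 0) (c 0) \<eta> R T (of_real t) x (y1 (of_real t, x)) (b1 t x)"
      proof -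
        have "of_real T * of_real t * ut (of_real T * of_real t, of_real R * x) =
            F (of_real T * of_real t, of_real R * x, of_real N * y1 (of_real t, x), of_real (\<eta> * R) * b1 t x)"
          using assms(17)[OF p] unfolding uN[symmetric] uxN[symmetric] by (simp add: ut_def ux_def)
        then show ?thesis
          unfolding rescaled_def N_def[symmetric] a1_def \<kappa>_def using N(1) by (simp add: field_simps)
      qed
      show "of_real t * D (of_real t) x = lam 0 * (\<lambda>(t, x). Y t x) (of_real t, x) + c 0 * x * V (of_real t) x +
          rescaled F (lam 0) (c 0) \<eta> R T (of_real t) x ((\<lambda>(t, x). Y t x) (of_real t, x)) (V (of_real t) x)"
        using EY tx by simp
      have "norm (y1 (of_real t, x)) \<le> 1"
        using ule[OF scaled(1,2,4)[OF tx]] N by (simp add: y1_def \<kappa>_def norm_mult norm_divide)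
      moreover have "norm (b1 t x) \<le> 1"
        using ux_le[OF scaled(1-3)[OF tx]] N R by (simp add: b1_def \<kappa>_def norm_mult norm_divide field_simps)
      ultimately show "norm (y1 (of_real t, x)) \<le> 1 \<and> norm (b1 t x) \<le> 1" ..
      show "norm ((\<lambda>(t, x). Y t x) (of_real t, x)) \<le> 1 \<and> norm (V (of_real t) x) \<le> 1"
        using BY tx by simp
    qed (use tx in auto)
    then show ?thesis by simp
  qed
  \<comment> \<open>The constructed solution in the original variables. It is holomorphic on a full
    bidisc that contains t = 0, and so it is the continuation.\<close>
  define w where "w p = of_real N * (\<lambda>(t, x). Y t x) (of_real (1 / T) * fst p, of_real (1 / R) * snd p)" for p
  show ?thesis
  proof (intro exI conjI ballI)
    show "open (ball (0::complex) T \<times> ball (0::complex) R)" by (simp add: open_Times)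
    show "(0, 0) \<in> ball (0::complex) T \<times> ball (0::complex) R" using T R by simp
    show "holomorphic2_on w (ball 0 T \<times> ball 0 R)"
      unfolding holomorphic2_on_def
    proof
      fix p :: "complex \<times> complex" assume p: "p \<in> ball 0 T \<times> ball 0 R"
      obtain t x where tx: "p = (t, x)" by fastforce
      have "norm (of_real (1 / T) * t) < 1" "norm (of_real (1 / R) * x) < 1"
        using p T R by (auto simp: tx norm_mult norm_divide)
      from has_derivative_rescale[OF DY[OF this], of "of_real N"]
      show "\<exists>a b. (w has_derivative (\<lambda>(h, k). a * h + b * k)) (at p)"
        unfolding w_def[abs_def] tx by blast
    qed
    show "0 < T" by (rule T(1))
    show "0 < R / 2" using R by simp
    fix p :: "complex \<times> complex" assume p: "p \<in> complex_of_real ` {0<..<T} \<times> ball 0 (R / 2)"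
    then obtain t x where tx: "p = (of_real t, x)" "0 < t" "t < T" "norm x < R / 2" by auto
    show "p \<in> ball 0 T \<times> ball 0 R" using tx R by simp
    show "p \<in> W" unfolding tx(1) by (rule inW) (use tx R in auto)
    have "y1 (of_real (t / T), of_real (1 / R) * x) = Y (of_real (t / T)) (of_real (1 / R) * x)"
      by (rule eq) (use tx T R in \<open>auto simp: norm_mult norm_divide field_simps\<close>)
    then show "w p = u p"
      using T R N by (simp add: w_def y1_def \<kappa>_def tx field_simps)
  qed
qed

end
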